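(* Let $T>0$, $\delta>0$, let $(x_t)_{t\ge0}$ be a standard one-dimensional Brownian motion with $x_0=0$, and let $\tau_\delta=\inf\{t\ge 0:|x_t|=\delta\}$. Set $\lambda=\frac{T\pi^2}{8\delta^2}$. Then $$\mathbb E\left[\int_0^{\tau_\delta\wedge T}x_s^2\,ds+\int_{\tau_\delta\wedge T}^{T}(x_s-x_{\tau_\delta\wedge T})^2\,ds\right]=\frac{T^2}{2}\left\{1+\frac{\pi^4}{32\lambda^2}-\frac{\pi^2}{4\lambda}-\frac{\pi}{\lambda^2}\sum_{k\ge0}\frac{(-1)^k e^{-(2k+1)^2\lambda}}{(2k+1)^3}\right\}.$$
   Context: The left-hand side is the aggregate squared error distortion over $[0,T]$ of Delta sampling with one sample and threshold $\delta$: one sample is taken when $|x_t|$ first reaches $\delta$ (with a time-out at $T$), the estimate being $0$ before the sample and the sample value afterwards. Here $a\wedge b=\min(a,b)$. *)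

theory Defs
  imports "HOL-Probability.Probability"
begin

(* Standard one-dimensional Brownian motion indexed by [0,\<infinity>).  The values of x at negative
   times are unconstrained.  normal_density takes the standard deviation, hence sqrt (t - s). *)
locale standard_brownian_motion = prob_space M for M :: "'a measure" +
  fixes x :: "real \<Rightarrow> 'a \<Rightarrow> real"
  assumes measurable: "\<And>t. 0 \<le> t \<Longrightarrow> random_variable borel (x t)"
    and start_at_zero: "\<And>\<omega>. \<omega> \<in> space M \<Longrightarrow> x 0 \<omega> = 0"
    and continuous_paths: "\<And>\<omega>. \<omega> \<in> space M \<Longrightarrow> continuous_on {0..} (\<lambda>t. x t \<omega>)"
    and independent_increments:
      "\<And>(n::nat) t. mono_on {..n} t \<Longrightarrow> 0 \<le> t 0 \<Longrightarrow>
         indep_vars (\<lambda>_. borel) (\<lambda>i \<omega>. x (t (Suc i)) \<omega> - x (t i) \<omega>) {..<n}"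
    and gaussian_increments:
      "\<And>s t. 0 \<le> s \<Longrightarrow> s < t \<Longrightarrow>
         distributed M lborel (\<lambda>\<omega>. x t \<omega> - x s \<omega>) (\<lambda>u. ennreal (normal_density 0 (sqrt (t - s)) u))"

(* Extended-real valued, so that the time is \<infinity> on paths that never reach the level \<delta>. *)
definition hitting_time :: "(real \<Rightarrow> 'a \<Rightarrow> real) \<Rightarrow> real \<Rightarrow> 'a \<Rightarrow> ereal" where
  "hitting_time x \<delta> \<omega> = Inf {ereal t | t. 0 \<le> t \<and> \<bar>x t \<omega>\<bar> = \<delta>}"

definition sampling_time :: "(real \<Rightarrow> 'a \<Rightarrow> real) \<Rightarrow> real \<Rightarrow> real \<Rightarrow> 'a \<Rightarrow> real" where
  "sampling_time x \<delta> T \<omega> = real_of_ereal (min (hitting_time x \<delta> \<omega>) (ereal T))"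

definition squared_error :: "(real \<Rightarrow> 'a \<Rightarrow> real) \<Rightarrow> real \<Rightarrow> real \<Rightarrow> 'a \<Rightarrow> real" where
  "squared_error x \<delta> T \<omega> =
     (let \<sigma> = sampling_time x \<delta> T \<omega> in
        (LINT s:{0..\<sigma>}|lborel. (x s \<omega>)\<^sup>2) + (LINT s:{\<sigma>..T}|lborel. (x s \<omega> - x \<sigma> \<omega>)\<^sup>2))"

end

(* Let sigma be the sampling time and y_s = x_(min sigma s).  Expanding the square,
     x_s^2 1_(s <= sigma) + (x_s - x_sigma)^2 1_(s > sigma) = x_s^2 - 2 (x_s - y_s) y_s - x_sigma^2 1_(s > sigma),
   and the middle term has mean 0, so the distortion is T^2/2 - E[x_sigma^2 (T - sigma)].  On sigma < T one has
   |x_sigma| = delta, so this equals T^2/2 - delta^2 (T - E sigma), and E sigma = E[x_sigma^2].  Finally the cosine series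
     delta^2 - y^2 = (32 delta^2 / pi^3) * sum_k (-1)^k cos (a_k y) / (2k+1)^3,   a_k = (2k+1) pi / (2 delta),
   on [-delta, delta] reduces E[delta^2 - x_sigma^2] to E[cos (a_k x_sigma)] = exp (- a_k^2 T / 2): optional stopping
   for exp (a_k^2 t / 2) cos (a_k x_t), which vanishes at the exit from (-delta, delta).

   Optional stopping is needed only for bounded continuous functions of the increment after sigma.  It holds exactly
   for the first time on a dyadic grid at which |x| reaches a level c (finitely many independent increments);
   then the grid is refined, and only afterwards c is raised to delta. *)
theory Submission
  imports Defs
begin

text \<open>On one grid the first time at or above a level \<open>c\<close> is easy to handle, but
  along refining grids it need not converge to the first time at which the path reaches
  \<open>c\<close>: a path can touch the level between grid points and turn back. The limit is only
  known to satisfy the level condition (or the time-out) and to come no later than any earlier time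
  at which |x| exceeds \<open>c\<close> strictly. At the exit |x| = \<delta> exceeds every
  \<open>c\<close> < \<delta> strictly, so raising \<open>c\<close> to \<delta> from below squeezes
  these limits onto \<open>sampling_time\<close> on every path; no almost sure statement about
  crossings enters.

  Both limits use dominated convergence. Hence stopping is stated for products \<phi>(x_s -
  x_\<sigma>) g(x_\<sigma>) of bounded factors, with \<phi> a sine or cosine whose mean over an
  increment comes from the characteristic function. Unbounded moments are recovered from sin(bz)/b
  and (1 - cos(bz))/b^2 as b tends to 0. The horizon s stays fixed throughout: min \<sigma> s is the
  sampling time with horizon s, and Fubini then integrates over s.\<close>

section \<open>A cosine series\<close>

text \<open>The factor 2 cos \<theta> turns the k-th sine into sin((2k+2)\<theta>) +
  sin(2k\<theta>), and the alternating signs make the sum telescope.\<close>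

lemma alternating_sin_sum:
  fixes \<theta> :: real
  shows "(\<Sum>k<N. (-1) ^ k * sin ((2 * real k + 1) * \<theta>)) * (2 * cos \<theta>) = - ((-1) ^ N * sin (2 * real N * \<theta>))"
proof (induction N)
  case (Suc N)
  have "2 * (sin ((2 * real N + 1) * \<theta>) * cos \<theta>) = sin (2 * real (Suc N) * \<theta>) + sin (2 * real N * \<theta>)"
    using sin_times_cos[of "(2 * real N + 1) * \<theta>" \<theta>] by (simp add: algebra_simps)
  then show ?case
    using Suc by (simp add: algebra_simps)
qed simp

text \<open>The derivative of \<open>S\<close> is (-1)^N sin(2Nu) / (2 cos u), which does not become
  small but oscillates with frequency 2N, so one integration by parts gains the factor 1/N. The
  price is the power of cos, which is harmless away from pi/2.\<close>

lemma alternating_cos_sum_bound: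
  fixes \<theta> :: real
  assumes "0 \<le> \<theta>" "\<theta> \<le> \<theta>\<^sub>0" "\<theta>\<^sub>0 < pi / 2" "0 < N"
  defines "S \<equiv> \<lambda>u. \<Sum>k<N. (-1) ^ k * cos ((2 * real k + 1) * u) / (2 * real k + 1)"
  shows "\<bar>S \<theta> - S 0\<bar> \<le> 1 / (real N * (cos \<theta>\<^sub>0)\<^sup>2)"
proof -
  define c where "c = cos \<theta>\<^sub>0"
  have c: "0 < c" "c \<le> 1"
    using assms by (auto simp: c_def intro!: cos_gt_zero_pi)
  have cos_ge: "c \<le> cos u" if "u \<in> {0..\<theta>\<^sub>0}" for u
    using that assms unfolding c_def by (intro cos_monotone_0_pi_le) auto
  \<comment> \<open>The added term cancels the boundary term of that integration by parts; the
    remaining integrand \<open>D\<close> already carries the factor 1/N.\<close>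
  define E where "E u = S u + (-1) ^ N * cos (2 * real N * u) / (4 * real N * cos u)" for u
  define D where "D u = (-1) ^ N * cos (2 * real N * u) * sin u / (4 * real N * (cos u)\<^sup>2)" for u
  have deriv: "(E has_field_derivative D u) (at u within {0..\<theta>\<^sub>0})" if u: "u \<in> {0..\<theta>\<^sub>0}" for u
  proof -
    have cu: "cos u \<noteq> 0" using cos_ge[OF u] c by auto
    have S': "(S has_field_derivative - (\<Sum>k<N. (-1) ^ k * sin ((2 * real k + 1) * u))) (at u within {0..\<theta>\<^sub>0})"
      unfolding S_def sum_negf[symmetric]
      by (intro DERIV_sum) (auto intro!: DERIV_cdivide[THEN DERIV_cong] derivative_eq_intros
           simp: add_nonneg_eq_0_iff)
    have S_eq: "- (\<Sum>k<N. (-1) ^ k * sin ((2 * real k + 1) * u)) = (-1) ^ N * sin (2 * real N * u) / (2 * cos u)"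
      using alternating_sin_sum[of u N] cu by (simp add: field_simps)
    have C': "((\<lambda>u. (-1) ^ N * cos (2 * real N * u) / (4 * real N * cos u)) has_field_derivative
        ((-1) ^ N * (- sin (2 * real N * u) * (2 * real N)) * (4 * real N * cos u)
          - (-1) ^ N * cos (2 * real N * u) * (4 * real N * - sin u))
        / ((4 * real N * cos u) * (4 * real N * cos u))) (at u within {0..\<theta>\<^sub>0})"
      using cu \<open>0 < N\<close> by (intro DERIV_divide) (auto intro!: derivative_eq_intros)
    have "(-1) ^ N * sin (2 * real N * u) / (2 * cos u) +
        ((-1) ^ N * (- sin (2 * real N * u) * (2 * real N)) * (4 * real N * cos u)
          - (-1) ^ N * cos (2 * real N * u) * (4 * real N * - sin u))
        / ((4 * real N * cos u) * (4 * real N * cos u)) = D u"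
      unfolding D_def using cu \<open>0 < N\<close> by (simp add: divide_simps power2_eq_square)
    thus ?thesis
      using DERIV_add[OF S'[unfolded S_eq] C'] by (simp add: E_def[abs_def])
  qed
  have D_le: "norm (D u) \<le> 1 / (4 * real N * c\<^sup>2)" if u: "u \<in> {0..\<theta>\<^sub>0}" for u
  proof -
    have "norm (D u) = \<bar>cos (2 * real N * u)\<bar> * \<bar>sin u\<bar> / (4 * real N * (cos u)\<^sup>2)"
      by (simp add: D_def abs_mult)
    also have "\<dots> \<le> 1 * 1 / (4 * real N * c\<^sup>2)"
      using c cos_ge[OF u] \<open>0 < N\<close>
      by (intro frac_le mult_mono power_mono) auto
    finally show ?thesis by simp
  qed
  have "norm (E \<theta> - E 0) \<le> 1 / (4 * real N * c\<^sup>2) * norm (\<theta> - 0)"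
    by (rule field_differentiable_bound[OF _ deriv D_le]) (use assms in auto)
  \<comment> \<open>The interval has length at most pi/2 < 2, which costs two units of 1/(4 N c^2).
    The corrections at \<theta> and at 0 cost one unit each, so the total is 1/(N c^2).\<close>
  also have "\<dots> \<le> 1 / (4 * real N * c\<^sup>2) * 2"
    using assms pi_less_4 by (intro mult_left_mono) auto
  finally have 1: "\<bar>E \<theta> - E 0\<bar> \<le> 2 * (1 / (4 * real N * c\<^sup>2))" by simp
  have 2: "\<bar>S u - E u\<bar> \<le> 1 / (4 * real N * c\<^sup>2)" if u: "u \<in> {0..\<theta>\<^sub>0}" for u
  proof -
    have "c\<^sup>2 \<le> cos u"
      using c cos_ge[OF u] by (smt (verit) mult_left_le power2_eq_square)
    have "\<bar>S u - E u\<bar> = \<bar>cos (2 * real N * u)\<bar> / (4 * real N * cos u)"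
      using cos_ge[OF u] c by (simp add: E_def abs_mult)
    also have "\<dots> \<le> 1 / (4 * real N * c\<^sup>2)"
      using c \<open>c\<^sup>2 \<le> cos u\<close> \<open>0 < N\<close> by (intro frac_le mult_left_mono) auto
    finally show ?thesis .
  qed
  have "\<bar>S \<theta> - S 0\<bar> \<le> \<bar>S \<theta> - E \<theta>\<bar> + \<bar>E \<theta> - E 0\<bar> + \<bar>S 0 - E 0\<bar>" by linarith
  moreover have "\<theta> \<in> {0..\<theta>\<^sub>0}" "0 \<in> {0..\<theta>\<^sub>0}" using assms by auto
  ultimately have "\<bar>S \<theta> - S 0\<bar> \<le> 4 * (1 / (4 * real N * c\<^sup>2))"
    using 1 2[of \<theta>] 2[of 0] by linarith
  thus ?thesis by (simp add: c_def)
qed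

text \<open>This is the Fourier series of a parabola. The second derivative of a partial sum is
  minus the sum \<open>S N\<close> below, which tends to Leibniz' value pi/4 uniformly on [0,u] for
  u < pi/2. Two applications of the mean value inequality to partial sums give the parabola up to
  the constant \<open>F 0\<close>; the limit itself is never differentiated.\<close>

lemma alternating_cos_cubes_sums:
  fixes \<theta> :: real
  assumes "\<bar>\<theta>\<bar> \<le> pi / 2"
  shows "(\<lambda>k. (-1) ^ k * cos ((2 * real k + 1) * \<theta>) / (2 * real k + 1) ^ 3) sums (pi ^ 3 / 32 - pi * \<theta>\<^sup>2 / 8)"
proof -
  define f where "f k u = (-1) ^ k * cos ((2 * real k + 1) * u) / (2 * real k + 1) ^ 3" for k and u :: real
  have f_le: "norm (f k u) \<le> 1 / (real (Suc k)) ^ 2" for k u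
  proof -
    have "(real (Suc k)) ^ 2 \<le> (2 * real k + 1) ^ 2" by (intro power_mono) auto
    also have "\<dots> \<le> (2 * real k + 1) ^ 3" by (intro power_increasing) auto
    finally show ?thesis
      unfolding f_def by (auto simp: abs_mult power_abs intro!: frac_le)
  qed
  have sq: "summable (\<lambda>k. 1 / (real (Suc k)) ^ 2)"
    using inverse_squares_sums by (simp add: sums_iff add.commute)
  have summ: "summable (\<lambda>k. f k u)" for u
    by (rule summable_comparison_test'[OF sq]) (use f_le in auto)
  define F where "F u = (\<Sum>k. f k u)" for u
  have lim: "(\<lambda>N. \<Sum>k<N. f k u) \<longlonglongrightarrow> F u" for u
    using summ unfolding F_def by (simp add: summable_LIMSEQ)
  have cont: "continuous_on UNIV F"
  proof (rule uniform_limit_theorem[where F = sequentially])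
    show "uniform_limit UNIV (\<lambda>N u. \<Sum>k<N. f k u) F sequentially"
      unfolding F_def by (rule Weierstrass_m_test[OF f_le sq])
    show "\<forall>\<^sub>F N in sequentially. continuous_on UNIV (\<lambda>u. \<Sum>k<N. f k u)"
      unfolding f_def by (intro always_eventually allI continuous_intros) auto
  qed simp
  have eq: "F u = F 0 - pi * u\<^sup>2 / 8" if u: "u \<in> {0..<pi/2}" for u
  proof -
    define S where "S N u = (\<Sum>k<N. (-1) ^ k * cos ((2 * real k + 1) * u) / (2 * real k + 1))" for N and u :: real
    \<comment> \<open>A bound for the distance of \<open>S N v\<close> from pi/4 that is uniform in
      v on [0,u] and tends to 0.\<close>
    define B where "B N = \<bar>S N 0 - pi / 4\<bar> + 1 / (real N * (cos u)\<^sup>2)" for N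
    have "(\<Sum>k. (-1) ^ k / (2 * real k + 1)) = pi / 4"
      using arctan_series[of 1] by (simp add: mult.commute add.commute)
    moreover have "(\<lambda>N. S N 0) \<longlonglongrightarrow> (\<Sum>k. (-1) ^ k / (2 * real k + 1))"
      using summable_LIMSEQ[OF summable_arctan_series[of 1]] by (simp add: S_def mult.commute add.commute)
    ultimately have "(\<lambda>N. S N 0) \<longlonglongrightarrow> pi / 4" by metis
    hence "(\<lambda>N. \<bar>S N 0 - pi / 4\<bar> + 1 / real N * (1 / (cos u)\<^sup>2)) \<longlonglongrightarrow> \<bar>pi / 4 - pi / 4\<bar> + 0 * (1 / (cos u)\<^sup>2)"
      by (intro tendsto_intros lim_1_over_n)
    hence B: "B \<longlonglongrightarrow> 0" by (simp add: B_def[abs_def])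
    \<comment> \<open>The function v |-> (partial sum) + pi v^2/8 has derivative \<open>- P\<close>,
      and \<open>P\<close> has derivative \<open>S N v - pi / 4\<close>. Each of the two
      integrations over [0,u] contributes a factor u.\<close>
    have "norm ((\<Sum>k<N. f k u) + pi * u\<^sup>2 / 8 - (\<Sum>k<N. f k 0)) \<le> B N * u * u" if "0 < N" for N
    proof -
      define P where "P v = (\<Sum>k<N. (-1) ^ k * sin ((2 * real k + 1) * v) / (2 * real k + 1) ^ 2) - pi * v / 4" for v
      have B0: "0 \<le> B N" by (simp add: B_def)
      have P': "(P has_field_derivative S N v - pi / 4) (at v within {0..u})" for v
      proof -
        have deriv_k: "((\<lambda>v. (-1) ^ k * sin ((2 * real k + 1) * v) / (2 * real k + 1) ^ 2) has_field_derivative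
            (-1) ^ k * cos ((2 * real k + 1) * v) / (2 * real k + 1)) (at v within {0..u})" for k
        proof -
          have "m \<noteq> 0 \<Longrightarrow> (-1) ^ k * (cos (m * v) * m) / m ^ 2 = (-1) ^ k * cos (m * v) / m" for m :: real
            by (simp add: power2_eq_square)
          thus ?thesis
            by (intro DERIV_cdivide[where D = "(-1) ^ k * (cos ((2 * real k + 1) * v) * (2 * real k + 1))", THEN DERIV_cong])
               (auto intro!: derivative_eq_intros simp: add_nonneg_eq_0_iff)
        qed
        show ?thesis
          unfolding P_def S_def
          by (rule DERIV_diff[OF DERIV_sum[OF deriv_k]]) (auto intro!: derivative_eq_intros)
      qed
      have S_le: "norm (S N v - pi / 4) \<le> B N" if "v \<in> {0..u}" for v
        using alternating_cos_sum_bound[of v u N] that u \<open>0 < N\<close> unfolding B_def S_def by auto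
      have P_le: "norm (- P v) \<le> B N * u" if v: "v \<in> {0..u}" for v
      proof -
        have "norm (P v - P 0) \<le> B N * norm (v - 0)"
          by (rule field_differentiable_bound[OF _ P' S_le]) (use v in auto)
        also have "\<dots> \<le> B N * u" using v B0 by (intro mult_left_mono) auto
        finally show ?thesis by (simp add: P_def)
      qed
      have F': "((\<lambda>v. (\<Sum>k<N. f k v) + pi * v\<^sup>2 / 8) has_field_derivative - P v) (at v within {0..u})" for v
      proof -
        have deriv_k: "(f k has_field_derivative
            - ((-1) ^ k * sin ((2 * real k + 1) * v) / (2 * real k + 1) ^ 2)) (at v within {0..u})" for k
        proof -
          have "m \<noteq> 0 \<Longrightarrow> (-1) ^ k * (- sin (m * v) * m) / m ^ 3 = - ((-1) ^ k * sin (m * v) / m ^ 2)" for m :: real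
            by (simp add: power2_eq_square power3_eq_cube)
          thus ?thesis
            unfolding f_def[abs_def]
            by (intro DERIV_cdivide[where D = "(-1) ^ k * (- sin ((2 * real k + 1) * v) * (2 * real k + 1))", THEN DERIV_cong])
               (auto intro!: derivative_eq_intros simp: add_nonneg_eq_0_iff)
        qed
        have "((\<lambda>v. pi * v\<^sup>2 / 8) has_field_derivative pi * v / 4) (at v within {0..u})"
          by (auto intro!: derivative_eq_intros)
        from DERIV_add[OF DERIV_sum[OF deriv_k] this] show ?thesis
          by (simp add: P_def sum_negf)
      qed
      have "norm (((\<Sum>k<N. f k u) + pi * u\<^sup>2 / 8) - ((\<Sum>k<N. f k 0) + pi * 0\<^sup>2 / 8)) \<le> B N * u * norm (u - 0)"
        by (rule field_differentiable_bound[OF _ F' P_le]) (use u in auto)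
      thus ?thesis using u by simp
    qed
    hence "\<forall>\<^sub>F N in sequentially. norm ((\<Sum>k<N. f k u) + pi * u\<^sup>2 / 8 - (\<Sum>k<N. f k 0)) \<le> B N * u * u"
      by (intro eventually_sequentiallyI[of 1]) simp
    moreover have "(\<lambda>N. B N * u * u) \<longlonglongrightarrow> 0"
      by (intro tendsto_mult_left_zero B)
    ultimately have "(\<lambda>N. (\<Sum>k<N. f k u) + pi * u\<^sup>2 / 8 - (\<Sum>k<N. f k 0)) \<longlonglongrightarrow> 0"
      by (rule Lim_null_comparison)
    moreover have "(\<lambda>N. (\<Sum>k<N. f k u) + pi * u\<^sup>2 / 8 - (\<Sum>k<N. f k 0)) \<longlonglongrightarrow> F u + pi * u\<^sup>2 / 8 - F 0"
      by (intro tendsto_intros lim)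
    ultimately have "F u + pi * u\<^sup>2 / 8 - F 0 = 0"
      by (rule LIMSEQ_unique[rotated])
    thus ?thesis by linarith
  qed
  \<comment> \<open>At pi/2 the bound \<open>B\<close> breaks down because cos u = 0, so the
    endpoint is reached by continuity of \<open>F\<close>.\<close>
  have eq': "F u = F 0 - pi * u\<^sup>2 / 8" if u: "u \<in> {0..pi/2}" for u
  proof -
    have "u \<in> closure {0..<pi/2}" using u by simp
    moreover have "closed {v. F v = F 0 - pi * v\<^sup>2 / 8}"
      using cont by (intro closed_Collect_eq) (auto intro!: continuous_intros)
    moreover have "{0..<pi/2} \<subseteq> {v. F v = F 0 - pi * v\<^sup>2 / 8}" using eq by blast
    ultimately show ?thesis
      using closure_minimal[of "{0..<pi/2}" "{v. F v = F 0 - pi * v\<^sup>2 / 8}"] by blast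
  qed
  \<comment> \<open>Every term vanishes at pi/2. This determines \<open>F 0\<close> without a
    separate evaluation of the alternating sum of inverse cubes.\<close>
  have "(2 * real k + 1) * (pi / 2) = pi * real (Suc (2 * k)) / 2" for k
    by (simp add: field_simps)
  hence "cos ((2 * real k + 1) * (pi / 2)) = 0" for k
    by (simp only: cos_pi_eq_zero)
  hence "F (pi / 2) = 0" by (simp add: F_def f_def)
  hence "F 0 = pi ^ 3 / 32"
    using eq'[of "pi / 2"] by (simp add: power2_eq_square power3_eq_cube)
  moreover have "F \<theta> = F \<bar>\<theta>\<bar>"
    by (cases "0 \<le> \<theta>") (simp_all add: F_def f_def)
  ultimately have "F \<theta> = pi ^ 3 / 32 - pi * \<theta>\<^sup>2 / 8"
    using eq'[of "\<bar>\<theta>\<bar>"] assms by simp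
  thus ?thesis
    using summ[of \<theta>] unfolding f_def F_def by (simp add: sums_iff)
qed

section \<open>Dyadic approximation of the sampling time\<close>

text \<open>By the intermediate value theorem a continuous path that starts at 0 cannot jump over
  \<delta>, and closedness of the level set makes the infimum a minimum \<open>m\<close>. In both
  cases \<open>T\<close> is quantified inside, so a single case split can compare different
  horizons.\<close>

lemma sampling_time_cases:
  assumes cont: "continuous_on {0..} (\<lambda>t. x t \<omega>)" and zero: "x 0 \<omega> = 0" and \<delta>: "0 < \<delta>"
  obtains (never) "\<And>t. 0 \<le> t \<Longrightarrow> \<bar>x t \<omega>\<bar> < \<delta>" "\<And>T. sampling_time x \<delta> T \<omega> = T"
  | (hit) m where "0 \<le> m" "\<bar>x m \<omega>\<bar> = \<delta>" "\<And>t. 0 \<le> t \<Longrightarrow> t < m \<Longrightarrow> \<bar>x t \<omega>\<bar> < \<delta>"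
      "\<And>T. sampling_time x \<delta> T \<omega> = min m T"
proof -
  define A where "A = {t. 0 \<le> t \<and> \<bar>x t \<omega>\<bar> = \<delta>}"
  have below: "\<bar>x t \<omega>\<bar> < \<delta>" if "0 \<le> t" and none: "\<And>u. 0 \<le> u \<Longrightarrow> u \<le> t \<Longrightarrow> \<bar>x u \<omega>\<bar> \<noteq> \<delta>" for t
  proof (rule ccontr)
    assume "\<not> \<bar>x t \<omega>\<bar> < \<delta>"
    moreover have "continuous_on {0..t} (\<lambda>t. \<bar>x t \<omega>\<bar>)"
      by (intro continuous_intros continuous_on_subset[OF cont]) auto
    ultimately have "\<exists>u\<ge>0. u \<le> t \<and> \<bar>x u \<omega>\<bar> = \<delta>"
      using \<open>0 \<le> t\<close> zero \<delta> by (intro IVT') auto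
    with none show False by blast
  qed
  have set_eq: "{ereal t | t. 0 \<le> t \<and> \<bar>x t \<omega>\<bar> = \<delta>} = ereal ` A"
    by (auto simp: A_def)
  show thesis
  proof (cases "A = {}")
    case True
    show thesis
    proof (rule never)
      show "\<bar>x t \<omega>\<bar> < \<delta>" if "0 \<le> t" for t
        using True that by (intro below) (auto simp: A_def)
      show "sampling_time x \<delta> T \<omega> = T" for T
        unfolding sampling_time_def hitting_time_def set_eq by (simp add: True top_ereal_def)
    qed
  next
    case False
    have "closed A"
    proof -
      have "A = {0..} \<inter> (\<lambda>t. \<bar>x t \<omega>\<bar>) -` {\<delta>}" by (auto simp: A_def)
      moreover have "closed \<dots>"
        by (intro continuous_closed_preimage continuous_intros cont)
      ultimately show ?thesis by simp
    qed
    have bdd: "bdd_below A" by (auto simp: A_def intro: bdd_belowI[of _ 0])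
    define m where "m = Inf A"
    have "m \<in> A"
      unfolding m_def by (rule closed_contains_Inf[OF False bdd \<open>closed A\<close>])
    have least: "m \<le> t" if "t \<in> A" for t
      unfolding m_def by (rule cInf_lower[OF that bdd])
    have Inf: "Inf (ereal ` A) = ereal m"
      by (rule antisym) (auto intro!: Inf_lower Inf_greatest \<open>m \<in> A\<close> least)
    show thesis
    proof (rule hit)
      show "0 \<le> m" "\<bar>x m \<omega>\<bar> = \<delta>" using \<open>m \<in> A\<close> by (auto simp: A_def)
      show "\<bar>x t \<omega>\<bar> < \<delta>" if "0 \<le> t" "t < m" for t
      proof (rule below[OF that(1)])
        show "\<bar>x u \<omega>\<bar> \<noteq> \<delta>" if "0 \<le> u" "u \<le> t" for u
          using least[of u] \<open>t < m\<close> that by (auto simp: A_def)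
      qed
      show "sampling_time x \<delta> T \<omega> = min m T" for T
        unfolding sampling_time_def hitting_time_def set_eq Inf by (simp add: min_def)
    qed
  qed
qed

text \<open>Two of these facts have later roles: \<open>sampling_time_min\<close> turns the path
  stopped at \<sigma>, observed at time s, into the sample with horizon s;
  \<open>sampling_time_eqI\<close> identifies limits of approximating times, of which only earliness
  and the stopping condition are known.\<close>

lemma
  assumes cont: "continuous_on {0..} (\<lambda>t. x t \<omega>)" and zero: "x 0 \<omega> = 0" and \<delta>: "0 < \<delta>" and T: "0 \<le> T"
  shows sampling_time_nonneg: "0 \<le> sampling_time x \<delta> T \<omega>"
    and sampling_time_le: "sampling_time x \<delta> T \<omega> \<le> T"
    and abs_sampled_le: "\<bar>x (sampling_time x \<delta> T \<omega>) \<omega>\<bar> \<le> \<delta>"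
    and abs_sampled_eq: "sampling_time x \<delta> T \<omega> < T \<Longrightarrow> \<bar>x (sampling_time x \<delta> T \<omega>) \<omega>\<bar> = \<delta>"
    and sampling_time_min: "0 \<le> s \<Longrightarrow> s \<le> T \<Longrightarrow> min (sampling_time x \<delta> T \<omega>) s = sampling_time x \<delta> s \<omega>"
    and sampling_time_eqI:
      "0 \<le> r \<Longrightarrow> r \<le> T \<Longrightarrow> r \<le> sampling_time x \<delta> T \<omega> \<Longrightarrow> r = T \<or> \<delta> \<le> \<bar>x r \<omega>\<bar> \<Longrightarrow> r = sampling_time x \<delta> T \<omega>"
proof -
  note c = sampling_time_cases[of x \<omega> \<delta>, OF cont zero \<delta>]
  show "0 \<le> sampling_time x \<delta> T \<omega>" by (cases rule: c) (use T in auto)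
  show "sampling_time x \<delta> T \<omega> \<le> T" by (cases rule: c) (use T in auto)
  show "\<bar>x (sampling_time x \<delta> T \<omega>) \<omega>\<bar> \<le> \<delta>"
    by (cases rule: c) (use T in \<open>auto simp: min_def less_imp_le\<close>)
  show "sampling_time x \<delta> T \<omega> < T \<Longrightarrow> \<bar>x (sampling_time x \<delta> T \<omega>) \<omega>\<bar> = \<delta>"
    by (cases rule: c) (use T in \<open>auto simp: min_def\<close>)
  show "0 \<le> s \<Longrightarrow> s \<le> T \<Longrightarrow> min (sampling_time x \<delta> T \<omega>) s = sampling_time x \<delta> s \<omega>"
    by (cases rule: c) auto
  show "0 \<le> r \<Longrightarrow> r \<le> T \<Longrightarrow> r \<le> sampling_time x \<delta> T \<omega> \<Longrightarrow> r = T \<or> \<delta> \<le> \<bar>x r \<omega>\<bar> \<Longrightarrow> r = sampling_time x \<delta> T \<omega>"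
    by (cases rule: c) (fastforce simp: min_def split: if_splits)+
qed

section \<open>Grid times along a single path\<close>

text \<open>The alternative \<open>i = 2 ^ n\<close> is the time-out at \<open>s\<close> and
  guarantees that the least index exists. The level condition is an inequality because a path seen
  only on a grid may jump over the level.\<close>

definition grid_index :: "(real \<Rightarrow> real) \<Rightarrow> real \<Rightarrow> real \<Rightarrow> nat \<Rightarrow> nat" where
  "grid_index f c s n = (LEAST i. i = 2 ^ n \<or> c \<le> \<bar>f (s * real i / 2 ^ n)\<bar>)"

definition grid_time :: "(real \<Rightarrow> real) \<Rightarrow> real \<Rightarrow> real \<Rightarrow> nat \<Rightarrow> real" where
  "grid_time f c s n = s * real (grid_index f c s n) / 2 ^ n"

text \<open>The grid times decrease under refinement, so the limit exists. It need not be the first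
  time at which |f| reaches \<open>c\<close>, since a contact with the level off the grid points can
  be missed.\<close>

definition dyadic_time :: "(real \<Rightarrow> real) \<Rightarrow> real \<Rightarrow> real \<Rightarrow> real" where
  "dyadic_time f c s = lim (grid_time f c s)"

lemma grid_index_le: "grid_index f c s n \<le> 2 ^ n"
  unfolding grid_index_def by (rule Least_le) simp

text \<open>This is the stopping time property: the event that the index is \<open>i\<close> depends
  only on the path at the grid points up to \<open>i\<close>. It is what allows the event to be
  written through the first \<open>i\<close> increments.\<close>

lemma grid_index_eq_iff:
  assumes "i \<le> 2 ^ n"
  shows "grid_index f c s n = i \<longleftrightarrow>
    (\<forall>j<i. \<bar>f (s * real j / 2 ^ n)\<bar> < c) \<and> (i = 2 ^ n \<or> c \<le> \<bar>f (s * real i / 2 ^ n)\<bar>)"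
    (is "_ \<longleftrightarrow> ?R")
proof
  assume i: "grid_index f c s n = i"
  have "i = 2 ^ n \<or> c \<le> \<bar>f (s * real i / 2 ^ n)\<bar>"
    unfolding i[symmetric] grid_index_def by (rule LeastI[of _ "2 ^ n"]) simp
  moreover have "\<bar>f (s * real j / 2 ^ n)\<bar> < c" if "j < i" for j
    using not_less_Least[of j "\<lambda>i. i = 2 ^ n \<or> c \<le> \<bar>f (s * real i / 2 ^ n)\<bar>"] that
    unfolding i[symmetric] grid_index_def by auto
  ultimately show ?R by blast
next
  assume R: ?R
  show "grid_index f c s n = i"
    unfolding grid_index_def
    by (rule Least_equality) (use R assms in \<open>auto simp: not_less[symmetric] simp del: not_less\<close>)
qed

lemma grid_time_bounds:
  assumes "0 \<le> s"
  shows "0 \<le> grid_time f c s n" "grid_time f c s n \<le> s"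
proof -
  show "0 \<le> grid_time f c s n" using assms by (simp add: grid_time_def)
  have "real (grid_index f c s n) \<le> 2 ^ n"
    using grid_index_le[of f c s n] by (metis of_nat_le_iff of_nat_numeral of_nat_power)
  thus "grid_time f c s n \<le> s"
    using assms by (simp add: grid_time_def field_simps mult_left_mono)
qed

lemma grid_time_level: "grid_time f c s n = s \<or> c \<le> \<bar>f (grid_time f c s n)\<bar>"
  using grid_index_eq_iff[of "grid_index f c s n" n f c s] grid_index_le[of f c s n]
  by (auto simp: grid_time_def)

lemma grid_time_le:
  assumes "0 \<le> s" "i \<le> 2 ^ n" "c \<le> \<bar>f (s * real i / 2 ^ n)\<bar>"
  shows "grid_time f c s n \<le> s * real i / 2 ^ n"
proof -
  have "grid_index f c s n \<le> i"
    unfolding grid_index_def by (rule Least_le) (use assms in simp)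
  thus ?thesis using assms by (simp add: grid_time_def divide_right_mono mult_left_mono)
qed

lemma grid_time_mono_level:
  assumes "0 \<le> s" "c \<le> d"
  shows "grid_time f c s n \<le> grid_time f d s n"
proof -
  have "grid_index f c s n \<le> grid_index f d s n"
    unfolding grid_index_def[of f c] 
    by (rule Least_le) (use grid_index_eq_iff[of "grid_index f d s n" n f d s] grid_index_le[of f d s n] assms in auto)
  thus ?thesis using assms by (simp add: grid_time_def divide_right_mono mult_left_mono)
qed

text \<open>The k-th point of a grid is the 2k-th point of the next one, so refinement only adds
  opportunities to stop.\<close>

lemma decseq_grid_time:
  assumes "0 \<le> s"
  shows "decseq (grid_time f c s)"
proof (rule decseq_SucI)
  fix n
  let ?k = "grid_index f c s n"
  have "grid_index f c s (Suc n) \<le> 2 * ?k"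
    unfolding grid_index_def[of f c s "Suc n"]
    by (rule Least_le) (use grid_index_eq_iff[of ?k n f c s] grid_index_le[of f c s n] in auto)
  hence "real (grid_index f c s (Suc n)) \<le> 2 * real ?k" by linarith
  thus "grid_time f c s (Suc n) \<le> grid_time f c s n"
    using mult_left_mono[OF _ assms] by (fastforce simp: grid_time_def field_simps)
qed

lemma grid_time_LIMSEQ:
  assumes "0 \<le> s"
  shows "grid_time f c s \<longlonglongrightarrow> dyadic_time f c s"
proof -
  have "Bseq (grid_time f c s)"
    by (rule BseqI'[of _ s]) (use grid_time_bounds[OF assms, of f c] in auto)
  hence "convergent (grid_time f c s)"
    using decseq_grid_time[OF assms] by (intro Bseq_monoseq_convergent) (auto simp: decseq_imp_monoseq)
  thus ?thesis by (simp add: dyadic_time_def convergent_LIMSEQ_iff)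
qed

lemma dyadic_time_bounds:
  assumes "0 \<le> s"
  shows "0 \<le> dyadic_time f c s" "dyadic_time f c s \<le> s"
  using LIMSEQ_le_const[OF grid_time_LIMSEQ[OF assms], of 0] LIMSEQ_le_const2[OF grid_time_LIMSEQ[OF assms], of _ _ s]
    grid_time_bounds[OF assms] by blast+

lemma dyadic_time_mono_level:
  assumes "0 \<le> s" "c \<le> d"
  shows "dyadic_time f c s \<le> dyadic_time f d s"
  by (rule LIMSEQ_le[OF grid_time_LIMSEQ grid_time_LIMSEQ]) (use assms grid_time_mono_level in blast)+

lemma continuous_LIMSEQ:
  assumes "continuous_on {0..} (f :: real \<Rightarrow> real)" "u \<longlonglongrightarrow> r" "\<And>n. 0 \<le> u n" 
  shows "(\<lambda>n. f (u n)) \<longlonglongrightarrow> f r"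
proof -
  have "0 \<le> r" using LIMSEQ_le_const[OF assms(2)] assms(3) by blast
  thus ?thesis
    by (intro continuous_on_tendsto_compose[OF assms(1,2)]) (use assms in auto)
qed

text \<open>If \<open>u n = s\<close> infinitely often, the limit is \<open>s\<close>; otherwise the
  level inequality holds eventually and passes to the limit by continuity. The level varies with n
  so that both refining the grid (constant level) and raising the level are covered.\<close>

lemma level_limit:
  assumes f: "continuous_on {0..} (f :: real \<Rightarrow> real)" and u: "u \<longlonglongrightarrow> r" "\<And>n. 0 \<le> u n" "\<And>n. u n \<le> s"
    and c: "c \<longlonglongrightarrow> d" and lev: "\<And>n. u n = s \<or> c n \<le> \<bar>f (u n)\<bar>"
  shows "r = s \<or> d \<le> \<bar>f r\<bar>"
proof (cases "frequently (\<lambda>n. u n = s) sequentially")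
  case True
  have "r = s"
  proof (rule ccontr)
    assume "r \<noteq> s"
    hence "\<forall>\<^sub>F n in sequentially. u n \<noteq> s"
      using u(1) by (rule tendsto_imp_eventually_ne[rotated])
    with True show False by (simp add: frequently_def)
  qed
  thus ?thesis ..
next
  case False
  hence ev: "\<forall>\<^sub>F n in sequentially. c n \<le> \<bar>f (u n)\<bar>"
    unfolding not_frequently by (rule eventually_mono) (use lev in blast)
  have "(\<lambda>n. \<bar>f (u n)\<bar>) \<longlonglongrightarrow> \<bar>f r\<bar>"
    by (intro tendsto_rabs continuous_LIMSEQ[OF f u(1,2)])
  hence "d \<le> \<bar>f r\<bar>"
    using tendsto_le[OF _ _ c ev] by simp
  thus ?thesis ..
qed

lemma dyadic_time_level:
  assumes "continuous_on {0..} f" "0 \<le> s"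
  shows "dyadic_time f c s = s \<or> c \<le> \<bar>f (dyadic_time f c s)\<bar>"
  by (rule level_limit[OF assms(1) grid_time_LIMSEQ[OF assms(2)], where c = "\<lambda>_. c"])
     (use grid_time_bounds[OF assms(2)] grid_time_level in auto)

text \<open>Strictness matters: if |f| exceeds \<open>c\<close> at t, it does so at nearby grid
  points as well, whereas a mere contact at t could be invisible to all grids.\<close>

lemma dyadic_time_le:
  assumes f: "continuous_on {0..} f" and t: "0 \<le> t" "t < s" "c < \<bar>f t\<bar>"
  shows "dyadic_time f c s \<le> t"
proof -
  \<comment> \<open>\<open>u n\<close> is t rounded up to the n-th grid; rounding up costs at most
    one mesh width s / 2^n, and t < s keeps the index within 2^n.\<close>
  define i where "i n = nat \<lceil>t / s * 2 ^ n\<rceil>" for n :: nat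
  define u where "u n = s * real (i n) / 2 ^ n" for n
  have s: "0 < s" using t by simp
  have i_eq: "real (i n) = of_int \<lceil>t / s * 2 ^ n\<rceil>" for n
  proof -
    have "0 \<le> t / s * 2 ^ n" using s t by simp
    thus ?thesis unfolding i_def by (intro of_nat_nat) (simp add: order.trans[of _ 0])
  qed
  have u_ge: "t \<le> u n" for n
  proof -
    have "t / s * 2 ^ n \<le> real (i n)" unfolding i_eq by linarith
    thus ?thesis using s by (simp add: u_def field_simps)
  qed
  have u_le: "u n \<le> t + s / 2 ^ n" for n
  proof -
    have "real (i n) \<le> t / s * 2 ^ n + 1" unfolding i_eq by linarith
    thus ?thesis using s by (simp add: u_def field_simps)
  qed
  have i_le: "i n \<le> 2 ^ n" for n
  proof -
    have "t / s * 2 ^ n \<le> 2 ^ n" using s t by (simp add: field_simps)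
    hence "\<lceil>t / s * 2 ^ n\<rceil> \<le> 2 ^ n" by (simp add: ceiling_le_iff)
    thus ?thesis unfolding i_def by (simp add: nat_le_iff)
  qed
  have "(\<lambda>n. t + s * (1 / 2) ^ n) \<longlonglongrightarrow> t + s * 0"
    by (intro tendsto_intros LIMSEQ_power_zero) auto
  hence lim: "(\<lambda>n. t + s / 2 ^ n) \<longlonglongrightarrow> t"
    by (simp add: power_divide)
  have u_lim: "u \<longlonglongrightarrow> t"
    by (rule tendsto_sandwich[OF _ _ tendsto_const lim]) (simp_all add: u_ge u_le)
  have u_nonneg: "0 \<le> u n" for n using u_ge[of n] t by linarith
  have "(\<lambda>n. \<bar>f (u n)\<bar>) \<longlonglongrightarrow> \<bar>f t\<bar>"
    by (intro tendsto_rabs continuous_LIMSEQ[OF f u_lim u_nonneg])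
  hence "\<forall>\<^sub>F n in sequentially. c < \<bar>f (u n)\<bar>"
    using t(3) by (rule order_tendstoD)
  hence "\<forall>\<^sub>F n in sequentially. grid_time f c s n \<le> u n"
    by (rule eventually_mono) (use s i_le in \<open>auto simp: u_def intro!: grid_time_le\<close>)
  thus ?thesis
    using s by (intro tendsto_le[OF _ u_lim grid_time_LIMSEQ]) auto
qed

text \<open>The times increase with the level and stay below the sampling time, so they converge;
  their limit inherits the stopping condition at level \<delta>, and
  \<open>sampling_time_eqI\<close> applies.\<close>

lemma dyadic_time_tendsto_sampling_time:
  assumes cont: "continuous_on {0..} (\<lambda>t. x t \<omega>)" and zero: "x 0 \<omega> = 0" and \<delta>: "0 < \<delta>" and s: "0 \<le> s"
  shows "(\<lambda>m. dyadic_time (\<lambda>t. x t \<omega>) (\<delta> - 1 / real (Suc m)) s) \<longlonglongrightarrow> sampling_time x \<delta> s \<omega>"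
proof -
  define f where "f t = x t \<omega>" for t
  define c where "c m = \<delta> - 1 / real (Suc m)" for m
  define u where "u m = dyadic_time f (c m) s" for m
  define \<sigma> where "\<sigma> = sampling_time x \<delta> s \<omega>"
  note props = sampling_time_nonneg[of x \<omega> \<delta>, OF cont zero \<delta> s] sampling_time_le[of x \<omega> \<delta>, OF cont zero \<delta> s]
    abs_sampled_eq[of x \<omega> \<delta>, OF cont zero \<delta> s]
  have f: "continuous_on {0..} f" using cont by (simp add: f_def[abs_def])
  have "incseq u"
    unfolding u_def c_def by (intro monoI dyadic_time_mono_level s) (auto simp: field_simps)
  \<comment> \<open>If \<sigma> < s then |f \<sigma>| = \<delta> > \<open>c m\<close>, the strict
    inequality that \<open>dyadic_time_le\<close> asks for. This is why the levels stay strictly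
    below \<delta>.\<close>
  have u_le: "u m \<le> \<sigma>" for m
  proof (cases "\<sigma> < s")
    case True
    thus ?thesis
      unfolding u_def using props by (intro dyadic_time_le[OF f]) (auto simp: \<sigma>_def f_def c_def)
  next
    case False
    thus ?thesis using dyadic_time_bounds(2)[OF s, of f "c m"] by (simp add: u_def)
  qed
  obtain r where r: "u \<longlonglongrightarrow> r" "r \<le> \<sigma>"
    using incseq_convergent[OF \<open>incseq u\<close>] u_le by (metis LIMSEQ_le_const2)
  have u0: "0 \<le> u m" for m unfolding u_def by (rule dyadic_time_bounds[OF s])
  have "0 \<le> r" using LIMSEQ_le_const[OF r(1)] u0 by blast
  have "c \<longlonglongrightarrow> \<delta> - 0"
    unfolding c_def using LIMSEQ_inverse_real_of_nat by (intro tendsto_intros) (simp add: inverse_eq_divide)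
  hence "r = s \<or> \<delta> \<le> \<bar>f r\<bar>"
    using dyadic_time_bounds[OF s] dyadic_time_level[OF f s]
    by (intro level_limit[OF f r(1), where c = c]) (auto simp: u_def)
  hence "r = \<sigma>"
    unfolding \<sigma>_def using r \<open>0 \<le> r\<close> props
    by (intro sampling_time_eqI[of x \<omega> \<delta>, OF cont zero \<delta> s]) (auto simp: f_def \<sigma>_def)
  thus ?thesis using r(1) by (simp add: u_def[abs_def] c_def f_def[abs_def] \<sigma>_def)
qed

section \<open>Optional stopping\<close>

text \<open>Both values are read off the characteristic function of a standard normal variable, as
  its real and imaginary parts.\<close>

lemma (in standard_brownian_motion) expectation_increment:
  assumes "0 \<le> s" "s \<le> t"
  shows expectation_cos_increment: "expectation (\<lambda>\<omega>. cos (b * (x t \<omega> - x s \<omega>))) = exp (- b\<^sup>2 * (t - s) / 2)"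
    and expectation_sin_increment: "expectation (\<lambda>\<omega>. sin (b * (x t \<omega> - x s \<omega>))) = 0"
proof -
  have "expectation (\<lambda>\<omega>. cos (b * (x t \<omega> - x s \<omega>))) = exp (- b\<^sup>2 * (t - s) / 2) \<and>
        expectation (\<lambda>\<omega>. sin (b * (x t \<omega> - x s \<omega>))) = 0"
  \<comment> \<open>A zero increment has no density, so the degenerate case is treated
    apart.\<close>
  proof (cases "s = t")
    case True
    thus ?thesis by (simp add: prob_space)
  next
    case False
    define v where "v = sqrt (t - s)"
    define Y where "Y \<omega> = (x t \<omega> - x s \<omega>) / v" for \<omega>
    have v: "0 < v" "v\<^sup>2 = t - s" using assms False by (auto simp: v_def)
    have D: "distributed M lborel Y std_normal_density"
      using gaussian_increments[of s t] normal_standard_normal_convert[OF v(1), of "\<lambda>\<omega>. x t \<omega> - x s \<omega>" 0] assms False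
      by (simp add: Y_def[abs_def] v_def)
    hence Y[measurable]: "random_variable borel Y"
      using distributed_measurable[OF D] by simp
    have "distr M borel Y = distr M lborel Y"
      by (rule distr_cong) auto
    hence std: "std_normal_distribution = distr M borel Y"
      using distributed_distr_eq_density[OF D] by simp
    define I where "I = (\<integral>\<omega>. iexp (b * v * Y \<omega>) \<partial>M)"
    have int: "integrable M (\<lambda>\<omega>. iexp (b * v * Y \<omega>))"
      by (rule integrable_iexp) auto
    have "I = char std_normal_distribution (b * v)"
      unfolding std char_def I_def by (subst integral_distr) auto
    also have "\<dots> = complex_of_real (exp (- b\<^sup>2 * (t - s) / 2))"
      by (simp add: char_std_normal_distribution power_mult_distrib v(2))
    finally have I: "I = complex_of_real (exp (- b\<^sup>2 * (t - s) / 2))" .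
    have eq: "b * (x t \<omega> - x s \<omega>) = b * v * Y \<omega>" for \<omega>
      using v(1) by (simp add: Y_def)
    have "expectation (\<lambda>\<omega>. cos (b * (x t \<omega> - x s \<omega>))) = Re I"
      unfolding I_def eq integral_Re[OF int, symmetric] by (simp add: Re_exp)
    moreover have "expectation (\<lambda>\<omega>. sin (b * (x t \<omega> - x s \<omega>))) = Im I"
      unfolding I_def eq integral_Im[OF int, symmetric] by (simp add: Im_exp)
    ultimately show ?thesis unfolding I by simp
  qed
  thus "expectation (\<lambda>\<omega>. cos (b * (x t \<omega> - x s \<omega>))) = exp (- b\<^sup>2 * (t - s) / 2)"
    "expectation (\<lambda>\<omega>. sin (b * (x t \<omega> - x s \<omega>))) = 0" by auto
qed

lemma (in standard_brownian_motion) second_moment: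
  assumes "0 \<le> t"
  shows integrable_square: "integrable M (\<lambda>\<omega>. (x t \<omega>)\<^sup>2)"
    and expectation_square: "expectation (\<lambda>\<omega>. (x t \<omega>)\<^sup>2) = t"
proof -
  have "integrable M (\<lambda>\<omega>. (x t \<omega>)\<^sup>2) \<and> expectation (\<lambda>\<omega>. (x t \<omega>)\<^sup>2) = t"
  proof (cases "t = 0")
    case True
    have "integrable M (\<lambda>\<omega>. (x t \<omega>)\<^sup>2) = integrable M (\<lambda>\<omega>. 0 :: real)"
      by (intro Bochner_Integration.integrable_cong) (simp_all add: True start_at_zero)
    moreover have "expectation (\<lambda>\<omega>. (x t \<omega>)\<^sup>2) = expectation (\<lambda>\<omega>. 0)"
      by (intro Bochner_Integration.integral_cong) (simp_all add: True start_at_zero)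
    ultimately show ?thesis by (simp add: True)
  next
    case False
    with assms have t: "0 < t" by simp
    have D: "distributed M lborel (x t) (\<lambda>u. ennreal (normal_density 0 (sqrt t) u))"
    proof -
      have "distributed M lborel (\<lambda>\<omega>. x t \<omega> - x 0 \<omega>) (\<lambda>u. ennreal (normal_density 0 (sqrt t) u))"
        using gaussian_increments[of 0 t] t by simp
      moreover have "distr M lborel (\<lambda>\<omega>. x t \<omega> - x 0 \<omega>) = distr M lborel (x t)"
        by (rule distr_cong) (auto simp: start_at_zero)
      ultimately show ?thesis
        using measurable[OF assms] by (simp add: distributed_def)
    qed
    have m: "has_bochner_integral lborel (\<lambda>u. normal_density 0 (sqrt t) u * (u - 0) ^ (2 * 1)) (fact (2 * 1) / ((2 / (sqrt t)\<^sup>2) ^ 1 * fact 1))"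
      by (rule normal_moment_even) (use t in simp)
    hence "has_bochner_integral lborel (\<lambda>u. normal_density 0 (sqrt t) u * u\<^sup>2) t"
      using t by simp
    hence "integrable lborel (\<lambda>u. normal_density 0 (sqrt t) u * u\<^sup>2)"
      "(\<integral>u. normal_density 0 (sqrt t) u * u\<^sup>2 \<partial>lborel) = t"
      unfolding has_bochner_integral_iff by blast+
    thus ?thesis
      using distributed_integrable[OF D, of "\<lambda>u. u\<^sup>2"] distributed_integral[OF D, of "\<lambda>u. u\<^sup>2"] by simp
  qed
  thus "integrable M (\<lambda>\<omega>. (x t \<omega>)\<^sup>2)" "expectation (\<lambda>\<omega>. (x t \<omega>)\<^sup>2) = t" by auto
qed

section \<open>Optional stopping on a finite grid and its limits\<close>

lemma (in standard_brownian_motion) measurable_grid_index: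
  assumes "0 \<le> s"
  shows "(\<lambda>\<omega>. grid_index (\<lambda>t. x t \<omega>) c s n) \<in> measurable M (count_space UNIV)"
proof -
  have [measurable]: "random_variable borel (x (s * real i / 2 ^ n))" for i
    using assms by (intro measurable) auto
  show ?thesis unfolding grid_index_def by measurable
qed

lemma (in standard_brownian_motion) measurable_grid_time:
  assumes "0 \<le> s"
  shows "random_variable borel (\<lambda>\<omega>. grid_time (\<lambda>t. x t \<omega>) c s n)"
    and "random_variable borel (\<lambda>\<omega>. x (grid_time (\<lambda>t. x t \<omega>) c s n) \<omega>)"
proof -
  note [measurable] = measurable_grid_index[OF assms]
  show "random_variable borel (\<lambda>\<omega>. grid_time (\<lambda>t. x t \<omega>) c s n)"
    unfolding grid_time_def by measurable
  show "random_variable borel (\<lambda>\<omega>. x (grid_time (\<lambda>t. x t \<omega>) c s n) \<omega>)"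
    unfolding grid_time_def
  proof (rule measurable_compose_countable[OF _ measurable_grid_index[OF assms]])
    show "random_variable borel (\<lambda>\<omega>. x (s * real i / 2 ^ n) \<omega>)" for i
      using assms by (intro measurable) auto
  qed
qed

text \<open>\<open>W\<close> is a function of the first \<open>i\<close> grid increments, and \<phi>
  is applied to the single increment from the i-th grid point to \<open>s\<close>; these are
  independent.\<close>

lemma (in standard_brownian_motion) expectation_grid_increment:
  fixes g \<phi> :: "real \<Rightarrow> real" and c :: real
  assumes s: "0 \<le> s" and i: "i \<le> 2 ^ n"
    and [measurable]: "g \<in> borel_measurable borel" "\<phi> \<in> borel_measurable borel"
    and bounds: "\<And>z. \<bar>g z\<bar> \<le> C" "\<And>z. \<bar>\<phi> z\<bar> \<le> B"
  defines "W \<equiv> \<lambda>\<omega>. if grid_index (\<lambda>t. x t \<omega>) c s n = i then g (x (s * real i / 2 ^ n) \<omega>) else 0"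
  shows "expectation (\<lambda>\<omega>. W \<omega> * \<phi> (x s \<omega> - x (s * real i / 2 ^ n) \<omega>)) =
    expectation W * expectation (\<lambda>\<omega>. \<phi> (x s \<omega> - x (s * real i / 2 ^ n) \<omega>))"
proof -
  \<comment> \<open>The first \<open>i\<close> steps follow the grid, and step number
    \<open>i\<close> goes straight to \<open>s\<close>. This gives \<open>Suc i\<close> increments,
    the last of which is zero when i = 2^n.\<close>
  define t where "t j = (if j \<le> i then s * real j / 2 ^ n else s)" for j
  define Z where "Z j \<omega> = x (t (Suc j)) \<omega> - x (t j) \<omega>" for j \<omega>
  \<comment> \<open>\<open>H\<close> is \<open>W\<close> rewritten in terms of increments: since the
    path starts at 0, the partial sums of the increments are its values at the grid points.\<close>
  define H where "H v = (if (\<forall>j\<in>{..<i}. \<bar>\<Sum>l<j. v l\<bar> < c) \<and> (i = 2 ^ n \<or> c \<le> \<bar>\<Sum>l<i. v l\<bar>)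
    then g (\<Sum>l<i. v l) else 0)" for v :: "nat \<Rightarrow> real"
  have real_le: "real j \<le> 2 ^ n" if "j \<le> i" for j
    using of_nat_mono[OF order.trans[OF that i], where 'a = real] by simp
  have "t j \<le> t k" if "j \<le> k" for j k
  proof (cases "k \<le> i")
    case True
    thus ?thesis using that s by (simp add: t_def divide_right_mono mult_left_mono)
  next
    case False
    thus ?thesis using s mult_left_mono[OF real_le[of j] s] by (simp add: t_def field_simps)
  qed
  hence "indep_vars (\<lambda>_. borel) Z {..<Suc i}"
    unfolding Z_def by (intro independent_increments) (auto simp: mono_on_def t_def)
  hence ind: "indep_var (PiM {..<i} (\<lambda>_. borel)) (\<lambda>\<omega>. restrict (\<lambda>j. Z j \<omega>) {..<i})
      (PiM {i} (\<lambda>_. borel)) (\<lambda>\<omega>. restrict (\<lambda>j. Z j \<omega>) {i})"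
    by (rule indep_var_restrict) auto
  have sum_comp: "(\<lambda>v. \<Sum>l<j. v l) \<in> borel_measurable (PiM {..<i} (\<lambda>_. borel :: real measure))"
    if "j \<le> i" for j
    using that by (intro borel_measurable_sum measurable_component_singleton) auto
  have H: "H \<in> borel_measurable (PiM {..<i} (\<lambda>_. borel))"
  proof -
    have 1[measurable]: "Measurable.pred (PiM {..<i} (\<lambda>_. borel :: real measure)) (\<lambda>v. \<forall>j\<in>{..<i}. \<bar>\<Sum>l<j. v l\<bar> < c)"
    proof (rule pred_intros_finite)
      fix j assume "j \<in> {..<i}"
      hence [measurable]: "(\<lambda>v. \<Sum>l<j. v l) \<in> borel_measurable (PiM {..<i} (\<lambda>_. borel :: real measure))"
        by (intro sum_comp) auto
      show "Measurable.pred (PiM {..<i} (\<lambda>_. borel :: real measure)) (\<lambda>v. \<bar>\<Sum>l<j. v l\<bar> < c)"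
        by measurable
    qed simp
    note [measurable] = sum_comp[OF order.refl]
    show ?thesis unfolding H_def[abs_def] by measurable
  qed
  have \<phi>: "(\<lambda>v. \<phi> (v i)) \<in> borel_measurable (PiM {i} (\<lambda>_. borel))"
    by measurable
  have H_eq: "H (restrict (\<lambda>j. Z j \<omega>) {..<i}) = W \<omega>" if "\<omega> \<in> space M" for \<omega>
  proof -
    have "(\<Sum>l<j. restrict (\<lambda>j. Z j \<omega>) {..<i} l) = x (s * real j / 2 ^ n) \<omega>" if "j \<le> i" for j
    proof -
      have "(\<Sum>l<j. restrict (\<lambda>j. Z j \<omega>) {..<i} l) = (\<Sum>l<j. x (t (Suc l)) \<omega> - x (t l) \<omega>)"
        using that by (intro sum.cong) (auto simp: Z_def)
      also have "\<dots> = x (t j) \<omega> - x (t 0) \<omega>" by (rule sum_lessThan_telescope)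
      finally show ?thesis using that start_at_zero[OF \<open>\<omega> \<in> space M\<close>] by (simp add: t_def)
    qed
    thus ?thesis unfolding H_def W_def grid_index_eq_iff[OF i] by auto
  qed
  have \<phi>_eq: "\<phi> (restrict (\<lambda>j. Z j \<omega>) {i} i) = \<phi> (x s \<omega> - x (s * real i / 2 ^ n) \<omega>)" for \<omega>
    by (simp add: Z_def t_def)
  have ind2: "indep_var borel (\<lambda>\<omega>. H (restrict (\<lambda>j. Z j \<omega>) {..<i})) borel (\<lambda>\<omega>. \<phi> (restrict (\<lambda>j. Z j \<omega>) {i} i))"
    using indep_var_compose[OF ind H \<phi>] by (simp add: comp_def)
  have int: "integrable M (\<lambda>\<omega>. H (restrict (\<lambda>j. Z j \<omega>) {..<i}))"
  proof (rule integrable_const_bound[where B = C])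
    have "0 \<le> C" using bounds(1)[of 0] by simp
    thus "AE \<omega> in M. norm (H (restrict (\<lambda>j. Z j \<omega>) {..<i})) \<le> C"
      using bounds(1) by (auto simp: H_def)
  qed (use indep_var_rv1[OF ind2] in simp)
  have int2: "integrable M (\<lambda>\<omega>. \<phi> (restrict (\<lambda>j. Z j \<omega>) {i} i))"
    by (rule integrable_const_bound[where B = B]) (use indep_var_rv2[OF ind2] bounds(2) in simp_all)
  have "expectation (\<lambda>\<omega>. W \<omega> * \<phi> (x s \<omega> - x (s * real i / 2 ^ n) \<omega>)) =
      expectation (\<lambda>\<omega>. H (restrict (\<lambda>j. Z j \<omega>) {..<i}) * \<phi> (restrict (\<lambda>j. Z j \<omega>) {i} i))"
    by (intro Bochner_Integration.integral_cong refl) (simp add: H_eq \<phi>_eq del: restrict_apply)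
  also have "\<dots> = expectation (\<lambda>\<omega>. H (restrict (\<lambda>j. Z j \<omega>) {..<i})) * expectation (\<lambda>\<omega>. \<phi> (restrict (\<lambda>j. Z j \<omega>) {i} i))"
    by (rule indep_var_lebesgue_integral[OF ind2 int int2])
  also have "expectation (\<lambda>\<omega>. H (restrict (\<lambda>j. Z j \<omega>) {..<i})) = expectation W"
    by (intro Bochner_Integration.integral_cong refl H_eq)
  finally show ?thesis by (simp only: \<phi>_eq)
qed

text \<open>Splitting by the value of the grid index replaces the random time by a fixed one on each
  piece, where independence turns \<phi> of the remaining increment into its mean \<psi>.\<close>

lemma (in standard_brownian_motion) grid_stopping:
  fixes g \<phi> \<psi> :: "real \<Rightarrow> real" and c :: real and n :: nat
  assumes s: "0 \<le> s"
    and [measurable]: "g \<in> borel_measurable borel" "\<phi> \<in> borel_measurable borel"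
    and bounds: "\<And>z. \<bar>g z\<bar> \<le> C" "\<And>z. \<bar>\<phi> z\<bar> \<le> B"
    and \<psi>: "\<And>u v. 0 \<le> u \<Longrightarrow> u \<le> v \<Longrightarrow> expectation (\<lambda>\<omega>. \<phi> (x v \<omega> - x u \<omega>)) = \<psi> (v - u)"
  defines "\<kappa> \<equiv> \<lambda>\<omega>. grid_time (\<lambda>t. x t \<omega>) c s n"
  shows "expectation (\<lambda>\<omega>. \<phi> (x s \<omega> - x (\<kappa> \<omega>) \<omega>) * g (x (\<kappa> \<omega>) \<omega>)) =
    expectation (\<lambda>\<omega>. \<psi> (s - \<kappa> \<omega>) * g (x (\<kappa> \<omega>) \<omega>))"
proof -
  define K where "K \<omega> = grid_index (\<lambda>t. x t \<omega>) c s n" for \<omega>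
  define t where "t i = s * real i / 2 ^ n" for i
  define W where "W i \<omega> = (if K \<omega> = i then g (x (t i) \<omega>) else 0)" for i \<omega>
  have K[measurable]: "K \<in> measurable M (count_space UNIV)"
    unfolding K_def[abs_def] by (rule measurable_grid_index[OF s])
  have t0: "0 \<le> t i" for i using s by (simp add: t_def)
  have t_le: "t i \<le> s" if "i \<le> 2 ^ n" for i
  proof -
    have "real i \<le> 2 ^ n" using of_nat_mono[OF that, where 'a = real] by simp
    thus ?thesis using s by (simp add: t_def field_simps mult_left_mono)
  qed
  have [measurable]: "random_variable borel (x (t i))" "random_variable borel (x s)" for i
    using measurable t0 s by auto
  have C: "0 \<le> C" "0 \<le> B" using bounds(1)[of 0] bounds(2)[of 0] by simp_all
  have W_le: "\<bar>W i \<omega>\<bar> \<le> C" for i \<omega> using bounds(1) C by (simp add: W_def)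
  have [measurable]: "random_variable borel (W i)" for i
    unfolding W_def[abs_def] by measurable
  have int1: "integrable M (\<lambda>\<omega>. W i \<omega> * \<phi> (x s \<omega> - x (t i) \<omega>))" for i
    by (rule integrable_const_bound[where B = "C * B"])
       (use W_le bounds(2) C in \<open>auto simp: abs_mult intro!: mult_mono\<close>)
  have int2: "integrable M (W i)" for i
    by (rule integrable_const_bound[where B = C]) (use W_le in auto)
  \<comment> \<open>Here \<omega> is fixed, so \<open>F\<close> may depend on it. The identity is
    used with \<open>F u\<close> equal to \<phi>(x_s - x_u) and to \<psi>(s - u).\<close>
  have split: "F (\<kappa> \<omega>) * g (x (\<kappa> \<omega>) \<omega>) = (\<Sum>i\<le>2 ^ n. W i \<omega> * F (t i))" for F :: "real \<Rightarrow> real" and \<omega>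
  proof -
    have "(\<Sum>i\<le>2 ^ n. W i \<omega> * F (t i)) = (\<Sum>i\<le>2 ^ n. if K \<omega> = i then F (t i) * g (x (t i) \<omega>) else 0)"
      by (intro sum.cong) (auto simp: W_def)
    also have "\<dots> = F (t (K \<omega>)) * g (x (t (K \<omega>)) \<omega>)"
      using grid_index_le[of "\<lambda>t. x t \<omega>" c s n] by (simp add: sum.delta' K_def)
    finally show ?thesis by (simp add: \<kappa>_def grid_time_def K_def t_def)
  qed
  have "expectation (\<lambda>\<omega>. \<phi> (x s \<omega> - x (\<kappa> \<omega>) \<omega>) * g (x (\<kappa> \<omega>) \<omega>)) =
      (\<Sum>i\<le>2 ^ n. expectation (\<lambda>\<omega>. W i \<omega> * \<phi> (x s \<omega> - x (t i) \<omega>)))"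
    unfolding split[of "\<lambda>u. \<phi> (x s \<omega> - x u \<omega>)" \<omega> for \<omega>] by (intro Bochner_Integration.integral_sum int1)
  also have "\<dots> = (\<Sum>i\<le>2 ^ n. expectation (\<lambda>\<omega>. W i \<omega> * \<psi> (s - t i)))"
  proof (intro sum.cong refl)
    fix i :: nat assume "i \<in> {..2 ^ n}"
    hence i: "i \<le> 2 ^ n" by simp
    have "expectation (\<lambda>\<omega>. W i \<omega> * \<phi> (x s \<omega> - x (t i) \<omega>)) = expectation (W i) * expectation (\<lambda>\<omega>. \<phi> (x s \<omega> - x (t i) \<omega>))"
      unfolding W_def[abs_def] K_def t_def
      by (rule expectation_grid_increment[OF s i assms(2,3) bounds])
    also have "expectation (\<lambda>\<omega>. \<phi> (x s \<omega> - x (t i) \<omega>)) = \<psi> (s - t i)"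
      by (rule \<psi>[OF t0 t_le[OF i]])
    finally show "expectation (\<lambda>\<omega>. W i \<omega> * \<phi> (x s \<omega> - x (t i) \<omega>)) = expectation (\<lambda>\<omega>. W i \<omega> * \<psi> (s - t i))"
      by simp
  qed
  also have "\<dots> = expectation (\<lambda>\<omega>. \<psi> (s - \<kappa> \<omega>) * g (x (\<kappa> \<omega>) \<omega>))"
    unfolding split[of "\<lambda>u. \<psi> (s - u)"]
    by (intro Bochner_Integration.integral_sum[symmetric] integrable_mult_left int2)
  finally show ?thesis .
qed

text \<open>Path continuity and dominated convergence with the constant B * C carry the identity and
  measurability to the limit. The bound on \<psi> is asked only for nonnegative arguments, because
  exp(- b^2 z / 2) is unbounded for negative z.\<close>

lemma (in standard_brownian_motion) stopping_limit:
  fixes g \<phi> \<psi> :: "real \<Rightarrow> real" and u :: "nat \<Rightarrow> 'a \<Rightarrow> real"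
  assumes s: "0 \<le> s"
    and cont: "continuous_on UNIV g" "continuous_on UNIV \<phi>" "continuous_on UNIV \<psi>"
    and bounds: "\<And>z. \<bar>g z\<bar> \<le> C" "\<And>z. \<bar>\<phi> z\<bar> \<le> B" "\<And>z. 0 \<le> z \<Longrightarrow> \<bar>\<psi> z\<bar> \<le> B"
    and u[measurable]: "\<And>n. random_variable borel (u n)" "\<And>n. random_variable borel (\<lambda>\<omega>. x (u n \<omega>) \<omega>)"
    and u_bounds: "\<And>n \<omega>. \<omega> \<in> space M \<Longrightarrow> 0 \<le> u n \<omega> \<and> u n \<omega> \<le> s"
    and eq: "\<And>n. expectation (\<lambda>\<omega>. \<phi> (x s \<omega> - x (u n \<omega>) \<omega>) * g (x (u n \<omega>) \<omega>)) =
      expectation (\<lambda>\<omega>. \<psi> (s - u n \<omega>) * g (x (u n \<omega>) \<omega>))"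
    and lim: "\<And>\<omega>. \<omega> \<in> space M \<Longrightarrow> (\<lambda>n. u n \<omega>) \<longlonglongrightarrow> r \<omega>"
  shows "random_variable borel r \<and> random_variable borel (\<lambda>\<omega>. x (r \<omega>) \<omega>) \<and>
    expectation (\<lambda>\<omega>. \<phi> (x s \<omega> - x (r \<omega>) \<omega>) * g (x (r \<omega>) \<omega>)) =
      expectation (\<lambda>\<omega>. \<psi> (s - r \<omega>) * g (x (r \<omega>) \<omega>))"
proof -
  have x_lim: "(\<lambda>n. x (u n \<omega>) \<omega>) \<longlonglongrightarrow> x (r \<omega>) \<omega>" if "\<omega> \<in> space M" for \<omega>
    by (rule continuous_LIMSEQ[OF continuous_paths[OF that] lim[OF that]]) (use u_bounds that in auto)
  have r[measurable]: "random_variable borel r"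
    by (rule borel_measurable_LIMSEQ_real[OF lim u(1)])
  have xr[measurable]: "random_variable borel (\<lambda>\<omega>. x (r \<omega>) \<omega>)"
    by (rule borel_measurable_LIMSEQ_real[OF x_lim u(2)])
  have [measurable]: "random_variable borel (x s)" by (rule measurable[OF s])
  note [measurable] = cont[THEN borel_measurable_continuous_onI]
  have pos: "0 \<le> C" "0 \<le> B" using bounds(1)[of 0] bounds(2)[of 0] by simp_all
  have at: "(\<lambda>n. f (w n)) \<longlonglongrightarrow> f l" if "continuous_on UNIV f" "w \<longlonglongrightarrow> l" for f :: "real \<Rightarrow> real" and w l
    using that by (intro continuous_on_tendsto_compose[OF that]) auto
  have "(\<lambda>n. expectation (\<lambda>\<omega>. \<phi> (x s \<omega> - x (u n \<omega>) \<omega>) * g (x (u n \<omega>) \<omega>)))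
      \<longlonglongrightarrow> expectation (\<lambda>\<omega>. \<phi> (x s \<omega> - x (r \<omega>) \<omega>) * g (x (r \<omega>) \<omega>))"
  proof (rule integral_dominated_convergence[where w = "\<lambda>_. B * C"])
    show "AE \<omega> in M. (\<lambda>n. \<phi> (x s \<omega> - x (u n \<omega>) \<omega>) * g (x (u n \<omega>) \<omega>))
        \<longlonglongrightarrow> \<phi> (x s \<omega> - x (r \<omega>) \<omega>) * g (x (r \<omega>) \<omega>)"
      by (intro AE_I2 tendsto_mult at[OF cont(1)] at[OF cont(2)] at[OF cont(3)] tendsto_diff tendsto_const x_lim)
    show "AE \<omega> in M. norm (\<phi> (x s \<omega> - x (u n \<omega>) \<omega>) * g (x (u n \<omega>) \<omega>)) \<le> B * C" for n
      using mult_mono[OF bounds(2,1) pos(2)] by (simp add: abs_mult)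
  qed simp_all
  moreover have "(\<lambda>n. expectation (\<lambda>\<omega>. \<psi> (s - u n \<omega>) * g (x (u n \<omega>) \<omega>)))
      \<longlonglongrightarrow> expectation (\<lambda>\<omega>. \<psi> (s - r \<omega>) * g (x (r \<omega>) \<omega>))"
  proof (rule integral_dominated_convergence[where w = "\<lambda>_. B * C"])
    show "AE \<omega> in M. (\<lambda>n. \<psi> (s - u n \<omega>) * g (x (u n \<omega>) \<omega>)) \<longlonglongrightarrow> \<psi> (s - r \<omega>) * g (x (r \<omega>) \<omega>)"
      by (intro AE_I2 tendsto_mult at[OF cont(1)] at[OF cont(2)] at[OF cont(3)] tendsto_diff tendsto_const lim x_lim)
    show "AE \<omega> in M. norm (\<psi> (s - u n \<omega>) * g (x (u n \<omega>) \<omega>)) \<le> B * C" for n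
    proof (rule AE_I2)
      fix \<omega> assume "\<omega> \<in> space M"
      hence "\<bar>\<psi> (s - u n \<omega>)\<bar> \<le> B" using u_bounds bounds(3) by simp
      thus "norm (\<psi> (s - u n \<omega>) * g (x (u n \<omega>) \<omega>)) \<le> B * C"
        using mult_mono[OF _ bounds(1) pos(2)] by (simp add: abs_mult)
    qed
  qed simp_all
  ultimately have "expectation (\<lambda>\<omega>. \<phi> (x s \<omega> - x (r \<omega>) \<omega>) * g (x (r \<omega>) \<omega>)) =
      expectation (\<lambda>\<omega>. \<psi> (s - r \<omega>) * g (x (r \<omega>) \<omega>))"
    unfolding eq by (rule LIMSEQ_unique)
  with r xr show ?thesis by blast
qed

text \<open>Two passages to the limit: along the grids at a fixed level, where the identity already
  holds for a time that need not be a hitting time, and then along the levels \<delta> -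
  1/(m+1).\<close>

lemma (in standard_brownian_motion) optional_stopping:
  fixes g \<phi> \<psi> :: "real \<Rightarrow> real"
  assumes s: "0 \<le> s" and \<delta>: "0 < \<delta>"
    and cont: "continuous_on UNIV g" "continuous_on UNIV \<phi>" "continuous_on UNIV \<psi>"
    and bounds: "\<And>z. \<bar>g z\<bar> \<le> C" "\<And>z. \<bar>\<phi> z\<bar> \<le> B" "\<And>z. 0 \<le> z \<Longrightarrow> \<bar>\<psi> z\<bar> \<le> B"
    and \<psi>: "\<And>u v. 0 \<le> u \<Longrightarrow> u \<le> v \<Longrightarrow> expectation (\<lambda>\<omega>. \<phi> (x v \<omega> - x u \<omega>)) = \<psi> (v - u)"
  defines "\<sigma> \<equiv> sampling_time x \<delta> s"
  shows "random_variable borel \<sigma>" "random_variable borel (\<lambda>\<omega>. x (\<sigma> \<omega>) \<omega>)"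
    and "expectation (\<lambda>\<omega>. \<phi> (x s \<omega> - x (\<sigma> \<omega>) \<omega>) * g (x (\<sigma> \<omega>) \<omega>)) =
      expectation (\<lambda>\<omega>. \<psi> (s - \<sigma> \<omega>) * g (x (\<sigma> \<omega>) \<omega>))"
proof -
  define d where "d c \<omega> = dyadic_time (\<lambda>t. x t \<omega>) c s" for c \<omega>
  note meas = cont[THEN borel_measurable_continuous_onI]
  have d: "random_variable borel (d c) \<and> random_variable borel (\<lambda>\<omega>. x (d c \<omega>) \<omega>) \<and>
    expectation (\<lambda>\<omega>. \<phi> (x s \<omega> - x (d c \<omega>) \<omega>) * g (x (d c \<omega>) \<omega>)) =
      expectation (\<lambda>\<omega>. \<psi> (s - d c \<omega>) * g (x (d c \<omega>) \<omega>))" for c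
    unfolding d_def[abs_def]
  proof (rule stopping_limit[OF s cont bounds, where u = "\<lambda>n \<omega>. grid_time (\<lambda>t. x t \<omega>) c s n"])
    show "expectation (\<lambda>\<omega>. \<phi> (x s \<omega> - x (grid_time (\<lambda>t. x t \<omega>) c s n) \<omega>) * g (x (grid_time (\<lambda>t. x t \<omega>) c s n) \<omega>)) =
        expectation (\<lambda>\<omega>. \<psi> (s - grid_time (\<lambda>t. x t \<omega>) c s n) * g (x (grid_time (\<lambda>t. x t \<omega>) c s n) \<omega>))" for n
      by (rule grid_stopping[OF s meas(1,2) bounds(1,2) \<psi>])
  qed (use grid_time_bounds[OF s] in \<open>auto intro: measurable_grid_time[OF s] grid_time_LIMSEQ[OF s]\<close>)
  have "random_variable borel \<sigma> \<and> random_variable borel (\<lambda>\<omega>. x (\<sigma> \<omega>) \<omega>) \<and>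
    expectation (\<lambda>\<omega>. \<phi> (x s \<omega> - x (\<sigma> \<omega>) \<omega>) * g (x (\<sigma> \<omega>) \<omega>)) =
      expectation (\<lambda>\<omega>. \<psi> (s - \<sigma> \<omega>) * g (x (\<sigma> \<omega>) \<omega>))"
  proof (rule stopping_limit[OF s cont, where u = "\<lambda>m. d (\<delta> - 1 / real (Suc m))"])
    fix \<omega> assume \<omega>: "\<omega> \<in> space M"
    show "(\<lambda>m. d (\<delta> - 1 / real (Suc m)) \<omega>) \<longlonglongrightarrow> \<sigma> \<omega>"
      unfolding \<sigma>_def d_def
      by (rule dyadic_time_tendsto_sampling_time[of x \<omega> \<delta> s, OF continuous_paths[OF \<omega>] start_at_zero[OF \<omega>] \<delta> s])
  qed (use d bounds dyadic_time_bounds[OF s] in \<open>auto simp: d_def\<close>)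
  thus "random_variable borel \<sigma>" "random_variable borel (\<lambda>\<omega>. x (\<sigma> \<omega>) \<omega>)"
    "expectation (\<lambda>\<omega>. \<phi> (x s \<omega> - x (\<sigma> \<omega>) \<omega>) * g (x (\<sigma> \<omega>) \<omega>)) =
      expectation (\<lambda>\<omega>. \<psi> (s - \<sigma> \<omega>) * g (x (\<sigma> \<omega>) \<omega>))" by blast+
qed

text \<open>Measurability is a by-product of the approximation by dyadic times, so zero functions
  suffice in the instance.\<close>

lemma (in standard_brownian_motion) measurable_sampling_time:
  assumes "0 \<le> s" "0 < \<delta>"
  shows "random_variable borel (sampling_time x \<delta> s)"
    and "random_variable borel (\<lambda>\<omega>. x (sampling_time x \<delta> s \<omega>) \<omega>)"
  using optional_stopping[OF assms, of "\<lambda>_. 0" "\<lambda>_. 0" "\<lambda>_. 0" 0 0] by auto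

section \<open>Moments recovered from bounded trigonometric functions\<close>

lemma sin_mult_div_tendsto: "((\<lambda>b. sin (b * z) / b) \<longlongrightarrow> z) (at (0::real))"
proof -
  have "((\<lambda>b. sin (b * z)) has_field_derivative z) (at 0)"
    by (auto intro!: derivative_eq_intros)
  thus ?thesis by (simp add: has_field_derivative_iff)
qed

text \<open>The half-angle formula writes the quotient as twice the square of sin(bz/2)/b, which
  reduces it to the limit for the sine.\<close>

lemma one_minus_cos_div_tendsto: "((\<lambda>b. (1 - cos (b * z)) / b\<^sup>2) \<longlongrightarrow> z\<^sup>2 / 2) (at (0::real))"
proof -
  have "((\<lambda>b. 2 * (sin (b * (z / 2)) / b)\<^sup>2) \<longlongrightarrow> 2 * (z / 2)\<^sup>2) (at 0)"
    by (intro tendsto_intros sin_mult_div_tendsto)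
  moreover have "2 * (sin (b * (z / 2)) / b)\<^sup>2 = (1 - cos (b * z)) / b\<^sup>2" for b
    using cos_double_sin[of "b * (z / 2)"] by (simp add: power_divide)
  ultimately show ?thesis by (simp only: power_divide) simp
qed

lemma one_minus_exp_div_tendsto: "((\<lambda>b. (1 - exp (- b\<^sup>2 * u / 2)) / b\<^sup>2) \<longlongrightarrow> u / 2) (at (0::real))"
proof -
  have "((\<lambda>c. 1 - exp (- c * u / 2)) has_field_derivative u / 2) (at 0)"
    by (auto intro!: derivative_eq_intros)
  hence "((\<lambda>c. (1 - exp (- c * u / 2)) / c) \<longlongrightarrow> u / 2) (at 0)"
    by (simp add: has_field_derivative_iff)
  moreover have "filterlim (\<lambda>b. b\<^sup>2) (at 0) (at (0::real))"
    unfolding filterlim_at by (auto intro!: tendsto_eq_intros simp: eventually_at_filter)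
  ultimately show ?thesis by (rule filterlim_compose)
qed

text \<open>A bound uniform in b, needed as a dominating function. At b = 0 the quotient is 0 by the
  convention for division by zero.\<close>

lemma one_minus_cos_div_le: "\<bar>(1 - cos (b * z)) / b\<^sup>2\<bar> \<le> z\<^sup>2 / (2::real)"
proof (cases "b = 0")
  case False
  have "(sin (b * (z / 2)))\<^sup>2 \<le> (b * (z / 2))\<^sup>2"
    by (rule abs_le_square_iff[THEN iffD1, OF abs_sin_x_le_abs_x])
  moreover have "cos (b * z) = 1 - 2 * (sin (b * (z / 2)))\<^sup>2"
    using cos_double_sin[of "b * (z / 2)"] by simp
  ultimately show ?thesis using False by (simp add: field_simps power_mult_distrib)
qed simp

lemma one_minus_exp_div_le:
  assumes "0 \<le> (u::real)"
  shows "\<bar>(1 - exp (- b\<^sup>2 * u / 2)) / b\<^sup>2\<bar> \<le> u / 2"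
proof (cases "b = 0")
  case False
  have "1 - exp (- b\<^sup>2 * u / 2) \<le> b\<^sup>2 * u / 2"
    using exp_ge_add_one_self[of "- b\<^sup>2 * u / 2"] by simp
  moreover have "exp (- b\<^sup>2 * u / 2) \<le> 1" using assms by simp
  ultimately show ?thesis using False by (simp add: abs_of_nonneg field_simps)
qed (use assms in simp)

lemma inverse_Suc_at_0: "filterlim (\<lambda>n. inverse (real (Suc n))) (at 0) sequentially"
  unfolding filterlim_at using LIMSEQ_inverse_real_of_nat by auto

text \<open>Optional stopping for sin(bz), divided by b, gives orthogonality of
  \<open>x s - Y\<close> and \<open>Y\<close> as b tends to 0. For (1 - cos(bz))/b^2 it gives
  E[(x_s - Y)^2] = s - E \<sigma>. Comparing with E[x_s^2] = s then yields the second moment of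
  \<open>Y\<close>.\<close>

lemma (in standard_brownian_motion) sampled_increment:
  assumes s: "0 \<le> s" and \<delta>: "0 < \<delta>"
  defines "Y \<equiv> \<lambda>\<omega>. x (sampling_time x \<delta> s \<omega>) \<omega>"
  shows integrable_sampled_increment: "integrable M (\<lambda>\<omega>. (x s \<omega> - Y \<omega>) * Y \<omega>)"
    and expectation_sampled_increment: "expectation (\<lambda>\<omega>. (x s \<omega> - Y \<omega>) * Y \<omega>) = 0"
    and expectation_sampled_square: "expectation (\<lambda>\<omega>. (Y \<omega>)\<^sup>2) = expectation (sampling_time x \<delta> s)"
proof -
  define \<sigma> where "\<sigma> = sampling_time x \<delta> s"
  define b where "b n = inverse (real (Suc n))" for n
  have b: "filterlim b (at 0) sequentially" unfolding b_def[abs_def] by (rule inverse_Suc_at_0)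
  note lims = filterlim_compose[OF _ b]
  have [measurable]: "random_variable borel \<sigma>" "random_variable borel Y" "random_variable borel (x s)"
    unfolding Y_def \<sigma>_def using measurable_sampling_time[OF s \<delta>] measurable[OF s] by auto
  have Y_le: "\<bar>Y \<omega>\<bar> \<le> \<delta>" and \<sigma>: "0 \<le> \<sigma> \<omega>" "\<sigma> \<omega> \<le> s" if "\<omega> \<in> space M" for \<omega>
    unfolding Y_def \<sigma>_def
    using abs_sampled_le[of x \<omega> \<delta> s] sampling_time_nonneg[of x \<omega> \<delta> s] sampling_time_le[of x \<omega> \<delta> s]
      continuous_paths[OF that] start_at_zero[OF that] \<delta> s by auto
  have sq: "integrable M (\<lambda>\<omega>. (x s \<omega>)\<^sup>2)" by (rule integrable_square[OF s])
  have lin: "integrable M (x s)" by (rule square_integrable_imp_integrable[OF _ sq]) simp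
  have int_\<sigma>: "integrable M \<sigma>"
    by (rule integrable_const_bound[where B = s]) (use \<sigma> in auto)
  have int_Y2: "integrable M (\<lambda>\<omega>. (Y \<omega>)\<^sup>2)"
    by (rule integrable_const_bound[where B = "\<delta>\<^sup>2"]) (use power_mono[OF Y_le, of _ 2] in auto)

  \<comment> \<open>optional stopping wants a bounded function on the whole line; truncation at the level does not change \<open>Y\<close>\<close>
  define clip where "clip y = max (- \<delta>) (min \<delta> y)" for y
  have clip: "clip (Y \<omega>) = Y \<omega>" if "\<omega> \<in> space M" for \<omega>
    using Y_le[OF that] by (auto simp: clip_def)
  have sin0: "expectation (\<lambda>\<omega>. sin (c * (x s \<omega> - Y \<omega>)) * clip (Y \<omega>)) = 0" for c
  proof -
    have "continuous_on UNIV clip" unfolding clip_def by (intro continuous_intros)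
    moreover have "\<bar>clip z\<bar> \<le> \<delta>" for z using \<delta> by (auto simp: clip_def)
    ultimately show ?thesis
      unfolding Y_def
      using optional_stopping(3)[OF s \<delta>, of clip "\<lambda>z. sin (c * z)" "\<lambda>_. 0" \<delta> 1] expectation_sin_increment
      by (simp add: continuous_intros)
  qed
  have lim1: "AE \<omega> in M. (\<lambda>n. sin (b n * (x s \<omega> - Y \<omega>)) / b n * Y \<omega>) \<longlonglongrightarrow> (x s \<omega> - Y \<omega>) * Y \<omega>"
    by (intro AE_I2 tendsto_mult tendsto_const lims[OF sin_mult_div_tendsto])
  have bound1: "AE \<omega> in M. norm (sin (b n * (x s \<omega> - Y \<omega>)) / b n * Y \<omega>) \<le> (\<bar>x s \<omega>\<bar> + \<delta>) * \<delta>" for n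
  proof (rule AE_I2)
    fix \<omega> assume \<omega>: "\<omega> \<in> space M"
    have "\<bar>sin (b n * (x s \<omega> - Y \<omega>)) / b n\<bar> \<le> \<bar>b n * (x s \<omega> - Y \<omega>)\<bar> / \<bar>b n\<bar>"
      unfolding abs_divide by (intro divide_right_mono abs_sin_x_le_abs_x) auto
    also have "\<dots> = \<bar>x s \<omega> - Y \<omega>\<bar>" by (simp add: abs_mult b_def)
    also have "\<dots> \<le> \<bar>x s \<omega>\<bar> + \<delta>" using Y_le[OF \<omega>] by linarith
    finally show "norm (sin (b n * (x s \<omega> - Y \<omega>)) / b n * Y \<omega>) \<le> (\<bar>x s \<omega>\<bar> + \<delta>) * \<delta>"
      unfolding real_norm_def abs_mult using Y_le[OF \<omega>] \<delta> by (intro mult_mono) auto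
  qed
  have dom1: "integrable M (\<lambda>\<omega>. (\<bar>x s \<omega>\<bar> + \<delta>) * \<delta>)"
    using lin by simp
  show int_ZY: "integrable M (\<lambda>\<omega>. (x s \<omega> - Y \<omega>) * Y \<omega>)"
    by (rule integrable_dominated_convergence[OF _ _ dom1 lim1 bound1]) measurable
  have "(\<lambda>n. expectation (\<lambda>\<omega>. sin (b n * (x s \<omega> - Y \<omega>)) / b n * Y \<omega>)) \<longlonglongrightarrow> expectation (\<lambda>\<omega>. (x s \<omega> - Y \<omega>) * Y \<omega>)"
    by (rule integral_dominated_convergence[OF _ _ dom1 lim1 bound1]) measurable
  moreover have "expectation (\<lambda>\<omega>. sin (b n * (x s \<omega> - Y \<omega>)) / b n * Y \<omega>) = 0" for n
  proof -
    have "expectation (\<lambda>\<omega>. sin (b n * (x s \<omega> - Y \<omega>)) / b n * Y \<omega>) =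
        expectation (\<lambda>\<omega>. sin (b n * (x s \<omega> - Y \<omega>)) * clip (Y \<omega>) / b n)"
      by (intro Bochner_Integration.integral_cong refl) (simp add: clip)
    thus ?thesis using sin0[of "b n"] by simp
  qed
  ultimately show ZY: "expectation (\<lambda>\<omega>. (x s \<omega> - Y \<omega>) * Y \<omega>) = 0"
    by (simp only: LIMSEQ_const_iff)

  have lim2: "AE \<omega> in M. (\<lambda>n. (1 - cos (b n * (x s \<omega> - Y \<omega>))) / (b n)\<^sup>2) \<longlonglongrightarrow> (x s \<omega> - Y \<omega>)\<^sup>2 / 2"
    by (intro AE_I2 lims[OF one_minus_cos_div_tendsto])
  have bound2: "AE \<omega> in M. norm ((1 - cos (b n * (x s \<omega> - Y \<omega>))) / (b n)\<^sup>2) \<le> (x s \<omega>)\<^sup>2 + \<delta>\<^sup>2" for n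
  proof (rule AE_I2)
    fix \<omega> assume \<omega>: "\<omega> \<in> space M"
    have "(x s \<omega> - Y \<omega>)\<^sup>2 / 2 \<le> (x s \<omega>)\<^sup>2 + (Y \<omega>)\<^sup>2"
      using zero_le_power2[of "x s \<omega> + Y \<omega>"] by (simp add: power2_sum power2_diff)
    moreover have "(Y \<omega>)\<^sup>2 \<le> \<delta>\<^sup>2" using power_mono[OF Y_le[OF \<omega>], of 2] by simp
    ultimately show "norm ((1 - cos (b n * (x s \<omega> - Y \<omega>))) / (b n)\<^sup>2) \<le> (x s \<omega>)\<^sup>2 + \<delta>\<^sup>2"
      unfolding real_norm_def using one_minus_cos_div_le[of "b n" "x s \<omega> - Y \<omega>"] by linarith
  qed
  have dom2: "integrable M (\<lambda>\<omega>. (x s \<omega>)\<^sup>2 + \<delta>\<^sup>2)" using sq by simp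
  have lim_cos: "(\<lambda>n. expectation (\<lambda>\<omega>. (1 - cos (b n * (x s \<omega> - Y \<omega>))) / (b n)\<^sup>2)) \<longlonglongrightarrow> expectation (\<lambda>\<omega>. (x s \<omega> - Y \<omega>)\<^sup>2 / 2)"
    by (rule integral_dominated_convergence[OF _ _ dom2 lim2 bound2]) measurable
  have lim_exp: "(\<lambda>n. expectation (\<lambda>\<omega>. (1 - exp (- (b n)\<^sup>2 * (s - \<sigma> \<omega>) / 2)) / (b n)\<^sup>2)) \<longlonglongrightarrow> expectation (\<lambda>\<omega>. (s - \<sigma> \<omega>) / 2)"
  proof (rule integral_dominated_convergence[where w = "\<lambda>_. s"])
    show "AE \<omega> in M. (\<lambda>n. (1 - exp (- (b n)\<^sup>2 * (s - \<sigma> \<omega>) / 2)) / (b n)\<^sup>2) \<longlonglongrightarrow> (s - \<sigma> \<omega>) / 2"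
      by (intro AE_I2 lims[OF one_minus_exp_div_tendsto])
    show "AE \<omega> in M. norm ((1 - exp (- (b n)\<^sup>2 * (s - \<sigma> \<omega>) / 2)) / (b n)\<^sup>2) \<le> s" for n
    proof (rule AE_I2)
      fix \<omega> assume \<omega>: "\<omega> \<in> space M"
      show "norm ((1 - exp (- (b n)\<^sup>2 * (s - \<sigma> \<omega>) / 2)) / (b n)\<^sup>2) \<le> s"
        unfolding real_norm_def
        by (rule order.trans[OF one_minus_exp_div_le]) (use \<sigma>[OF \<omega>] in simp_all)
    qed
  qed simp_all
  have cos_eq_exp: "expectation (\<lambda>\<omega>. (1 - cos (c * (x s \<omega> - Y \<omega>))) / c\<^sup>2) =
      expectation (\<lambda>\<omega>. (1 - exp (- c\<^sup>2 * (s - \<sigma> \<omega>) / 2)) / c\<^sup>2)" for c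
  proof -
    have "expectation (\<lambda>\<omega>. cos (c * (x s \<omega> - Y \<omega>)) * 1) = expectation (\<lambda>\<omega>. exp (- c\<^sup>2 * (s - \<sigma> \<omega>) / 2) * 1)"
      unfolding Y_def \<sigma>_def
      by (rule optional_stopping(3)[OF s \<delta>, where C = 1 and B = 1, OF _ _ _ _ _ _ expectation_cos_increment])
         (auto intro!: continuous_intros)
    moreover have "integrable M (\<lambda>\<omega>. cos (c * (x s \<omega> - Y \<omega>)))"
      by (rule integrable_const_bound[where B = 1]) auto
    moreover have "integrable M (\<lambda>\<omega>. exp (- c\<^sup>2 * (s - \<sigma> \<omega>) / 2))"
      by (rule integrable_const_bound[where B = 1]) (use \<sigma> in auto)
    ultimately show ?thesis by simp
  qed
  have "expectation (\<lambda>\<omega>. (x s \<omega> - Y \<omega>)\<^sup>2 / 2) = expectation (\<lambda>\<omega>. (s - \<sigma> \<omega>) / 2)"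
    by (rule LIMSEQ_unique[OF lim_cos[unfolded cos_eq_exp] lim_exp])
  hence Z2: "expectation (\<lambda>\<omega>. (x s \<omega> - Y \<omega>)\<^sup>2) = s - expectation \<sigma>"
    using int_\<sigma> by (simp add: prob_space)
  \<comment> \<open>Taking expectations term by term gives s = (s - E \<sigma>) + 0 +
    E[Y^2].\<close>
  have eq: "(x s \<omega>)\<^sup>2 = (x s \<omega> - Y \<omega>)\<^sup>2 + 2 * ((x s \<omega> - Y \<omega>) * Y \<omega>) + (Y \<omega>)\<^sup>2" for \<omega>
    by (simp add: power2_eq_square algebra_simps)
  have int_Z2: "integrable M (\<lambda>\<omega>. (x s \<omega> - Y \<omega>)\<^sup>2)"
  proof -
    have "integrable M (\<lambda>\<omega>. (x s \<omega>)\<^sup>2 - 2 * ((x s \<omega> - Y \<omega>) * Y \<omega>) - (Y \<omega>)\<^sup>2)"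
      by (intro Bochner_Integration.integrable_diff integrable_mult_right sq int_ZY int_Y2)
    thus ?thesis unfolding eq by simp
  qed
  have "s = expectation (\<lambda>\<omega>. (x s \<omega> - Y \<omega>)\<^sup>2 + 2 * ((x s \<omega> - Y \<omega>) * Y \<omega>) + (Y \<omega>)\<^sup>2)"
    using expectation_square[OF s] unfolding eq by simp
  also have "\<dots> = s - expectation \<sigma> + expectation (\<lambda>\<omega>. (Y \<omega>)\<^sup>2)"
    using int_Z2 int_ZY int_Y2 ZY Z2 by simp
  finally show "expectation (\<lambda>\<omega>. (Y \<omega>)\<^sup>2) = expectation (sampling_time x \<delta> s)"
    by (simp add: \<sigma>_def)
qed

text \<open>With x_s = (x_s - Y) + Y the addition formula splits cos(a x_s) into two products of the
  form covered by optional stopping; the sine product has mean 0.\<close>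

lemma (in standard_brownian_motion) expectation_cos_sampled:
  assumes s: "0 \<le> s" and \<delta>: "0 < \<delta>" and a: "cos (a * \<delta>) = 0"
  shows "expectation (\<lambda>\<omega>. cos (a * x (sampling_time x \<delta> s \<omega>) \<omega>)) = exp (- a\<^sup>2 * s / 2)"
proof -
  define \<sigma> where "\<sigma> = sampling_time x \<delta> s"
  define Y where "Y \<omega> = x (\<sigma> \<omega>) \<omega>" for \<omega>
  have [measurable]: "random_variable borel \<sigma>" "random_variable borel Y" "random_variable borel (x s)"
    unfolding Y_def[abs_def] \<sigma>_def using measurable_sampling_time[OF s \<delta>] measurable[OF s] by auto
  \<comment> \<open>The weight exp(- a^2 (s - \<sigma>) / 2) disappears: it is 1 at the time-out,
    and before it the cosine at the level \<delta> or - \<delta> is 0.\<close>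
  have killed: "exp (- a\<^sup>2 * (s - \<sigma> \<omega>) / 2) * cos (a * Y \<omega>) = cos (a * Y \<omega>)" if \<omega>: "\<omega> \<in> space M" for \<omega>
  proof (cases "\<sigma> \<omega> < s")
    case True
    hence "\<bar>Y \<omega>\<bar> = \<delta>"
      unfolding Y_def \<sigma>_def
      using abs_sampled_eq[of x \<omega> \<delta> s, OF continuous_paths[OF \<omega>] start_at_zero[OF \<omega>] \<delta> s] by blast
    hence "Y \<omega> = \<delta> \<or> Y \<omega> = - \<delta>" by linarith
    thus ?thesis using a by auto
  next
    case False
    hence "\<sigma> \<omega> = s"
      using sampling_time_le[of x \<omega> \<delta> s, OF continuous_paths[OF \<omega>] start_at_zero[OF \<omega>] \<delta> s] by (simp add: \<sigma>_def)
    thus ?thesis by simp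
  qed
  have cc: "expectation (\<lambda>\<omega>. cos (a * (x s \<omega> - Y \<omega>)) * cos (a * Y \<omega>)) =
      expectation (\<lambda>\<omega>. exp (- a\<^sup>2 * (s - \<sigma> \<omega>) / 2) * cos (a * Y \<omega>))"
    unfolding Y_def \<sigma>_def
    by (rule optional_stopping(3)[OF s \<delta>, where C = 1 and B = 1, OF _ _ _ _ _ _ expectation_cos_increment])
       (auto intro!: continuous_intros)
  have ss: "expectation (\<lambda>\<omega>. sin (a * (x s \<omega> - Y \<omega>)) * sin (a * Y \<omega>)) = expectation (\<lambda>\<omega>. 0 * sin (a * Y \<omega>))"
    unfolding Y_def \<sigma>_def
    by (rule optional_stopping(3)[OF s \<delta>, where C = 1 and B = 1, OF _ _ _ _ _ _ expectation_sin_increment])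
       (auto intro!: continuous_intros)
  have int: "integrable M (\<lambda>\<omega>. cos (a * (x s \<omega> - Y \<omega>)) * cos (a * Y \<omega>))"
    "integrable M (\<lambda>\<omega>. sin (a * (x s \<omega> - Y \<omega>)) * sin (a * Y \<omega>))"
    by (rule integrable_const_bound[where B = 1]; simp add: abs_mult mult_le_one)+
  have "exp (- a\<^sup>2 * s / 2) = expectation (\<lambda>\<omega>. cos (a * (x s \<omega> - x 0 \<omega>)))"
    using expectation_cos_increment[of 0 s a] s by simp
  also have "\<dots> = expectation (\<lambda>\<omega>. cos (a * (x s \<omega> - Y \<omega>)) * cos (a * Y \<omega>) - sin (a * (x s \<omega> - Y \<omega>)) * sin (a * Y \<omega>))"
    by (intro Bochner_Integration.integral_cong refl)
       (simp add: start_at_zero right_diff_distrib flip: cos_add)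
  also have "\<dots> = expectation (\<lambda>\<omega>. exp (- a\<^sup>2 * (s - \<sigma> \<omega>) / 2) * cos (a * Y \<omega>))"
    using int cc ss by simp
  also have "\<dots> = expectation (\<lambda>\<omega>. cos (a * Y \<omega>))"
    by (intro Bochner_Integration.integral_cong refl killed)
  finally show ?thesis by (simp add: Y_def \<sigma>_def)
qed

text \<open>The cubes make the terms at most 1/(k+1)^2 in absolute value, uniformly in \<omega>, so
  the parabola series at \<open>Y\<close> may be integrated term by term.\<close>

lemma (in standard_brownian_motion) expectation_sampling_time:
  assumes s: "0 \<le> s" and \<delta>: "0 < \<delta>"
  shows "(\<lambda>k. (-1) ^ k * exp (- (2 * real k + 1)\<^sup>2 * (s * pi\<^sup>2 / (8 * \<delta>\<^sup>2))) / (2 * real k + 1) ^ 3) sums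
    (pi ^ 3 / (32 * \<delta>\<^sup>2) * (\<delta>\<^sup>2 - expectation (sampling_time x \<delta> s)))"
proof -
  define Y where "Y \<omega> = x (sampling_time x \<delta> s \<omega>) \<omega>" for \<omega>
  define f where "f k \<omega> = (-1) ^ k * cos ((2 * real k + 1) * (pi * Y \<omega> / (2 * \<delta>))) / (2 * real k + 1) ^ 3" for k \<omega>
  have [measurable]: "random_variable borel Y"
    unfolding Y_def[abs_def] using measurable_sampling_time[OF s \<delta>] by auto
  have Y_le: "\<bar>Y \<omega>\<bar> \<le> \<delta>" if "\<omega> \<in> space M" for \<omega>
    unfolding Y_def using abs_sampled_le[of x \<omega> \<delta> s, OF continuous_paths[OF that] start_at_zero[OF that] \<delta> s] .
  have [measurable]: "random_variable borel (f k)" for k unfolding f_def[abs_def] by measurable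
  have f_le: "norm (f k \<omega>) \<le> 1 / (real (Suc k)) ^ 2" for k \<omega>
  proof -
    have "(real (Suc k)) ^ 2 \<le> (2 * real k + 1) ^ 2" by (intro power_mono) auto
    also have "\<dots> \<le> (2 * real k + 1) ^ 3" by (intro power_increasing) auto
    finally show ?thesis
      unfolding f_def by (auto simp: abs_mult power_abs intro!: frac_le)
  qed
  have sq: "summable (\<lambda>k. 1 / (real (Suc k)) ^ 2)"
    using inverse_squares_sums by (simp add: sums_iff add.commute)
  have int: "integrable M (f k)" for k
    by (rule integrable_const_bound[OF AE_I2[OF f_le]]) simp
  have int_norm: "expectation (\<lambda>\<omega>. norm (f k \<omega>)) \<le> 1 / (real (Suc k)) ^ 2" for k
    using integral_mono[OF integrable_norm[OF int] integrable_const f_le] by (simp add: prob_space)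
  have f_sums: "(\<lambda>k. f k \<omega>) sums (pi ^ 3 / (32 * \<delta>\<^sup>2) * (\<delta>\<^sup>2 - (Y \<omega>)\<^sup>2))" if \<omega>: "\<omega> \<in> space M" for \<omega>
  proof -
    \<comment> \<open>This scaling maps [-\<delta>, \<delta>] onto [-pi/2, pi/2], the full range on
      which the series represents the parabola.\<close>
    have "\<bar>pi * Y \<omega> / (2 * \<delta>)\<bar> \<le> pi / 2"
      using Y_le[OF \<omega>] \<delta> by (simp add: abs_mult field_simps)
    from alternating_cos_cubes_sums[OF this] have "(\<lambda>k. f k \<omega>) sums (pi ^ 3 / 32 - pi * (pi * Y \<omega> / (2 * \<delta>))\<^sup>2 / 8)"
      by (simp add: f_def)
    also have "pi ^ 3 / 32 - pi * (pi * Y \<omega> / (2 * \<delta>))\<^sup>2 / 8 = pi ^ 3 / (32 * \<delta>\<^sup>2) * (\<delta>\<^sup>2 - (Y \<omega>)\<^sup>2)"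
      using \<delta> by (simp add: field_simps power2_eq_square power3_eq_cube)
    finally show ?thesis by simp
  qed
  have "(\<lambda>k. expectation (f k)) sums expectation (\<lambda>\<omega>. \<Sum>k. f k \<omega>)"
  proof (rule sums_integral[OF int])
    show "AE \<omega> in M. summable (\<lambda>k. norm (f k \<omega>))"
      by (intro AE_I2 summable_comparison_test'[OF sq]) (use f_le in auto)
    show "summable (\<lambda>k. expectation (\<lambda>\<omega>. norm (f k \<omega>)))"
      by (rule summable_comparison_test'[OF sq]) (use int_norm in auto)
  qed
  also have "expectation (\<lambda>\<omega>. \<Sum>k. f k \<omega>) = expectation (\<lambda>\<omega>. pi ^ 3 / (32 * \<delta>\<^sup>2) * (\<delta>\<^sup>2 - (Y \<omega>)\<^sup>2))"
    by (intro Bochner_Integration.integral_cong refl) (use f_sums in \<open>auto simp: sums_iff\<close>)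
  also have "\<dots> = pi ^ 3 / (32 * \<delta>\<^sup>2) * (\<delta>\<^sup>2 - expectation (\<lambda>\<omega>. (Y \<omega>)\<^sup>2))"
  proof -
    have "integrable M (\<lambda>\<omega>. (Y \<omega>)\<^sup>2)"
      by (rule integrable_const_bound[where B = "\<delta>\<^sup>2"]) (use power_mono[OF Y_le, of _ 2] in auto)
    thus ?thesis by (simp add: prob_space)
  qed
  also have "expectation (\<lambda>\<omega>. (Y \<omega>)\<^sup>2) = expectation (sampling_time x \<delta> s)"
    unfolding Y_def by (rule expectation_sampled_square[OF s \<delta>])
  finally have sums: "(\<lambda>k. expectation (f k)) sums
    (pi ^ 3 / (32 * \<delta>\<^sup>2) * (\<delta>\<^sup>2 - expectation (sampling_time x \<delta> s)))" .
  have "expectation (f k) = (-1) ^ k * exp (- (2 * real k + 1)\<^sup>2 * (s * pi\<^sup>2 / (8 * \<delta>\<^sup>2))) / (2 * real k + 1) ^ 3" for k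
  proof -
    \<comment> \<open>The frequency for which a \<delta> is the (2k+1)-fold of pi/2, so that the
      cosine vanishes at the exit; a^2 s / 2 is then (2k+1)^2 times the parameter \<lambda> with
      horizon s.\<close>
    define a where "a = (2 * real k + 1) * pi / (2 * \<delta>)"
    have "a * \<delta> = pi * real (Suc (2 * k)) / 2" using \<delta> by (simp add: a_def field_simps)
    hence "cos (a * \<delta>) = 0" by (simp only: cos_pi_eq_zero)
    hence E: "expectation (\<lambda>\<omega>. cos (a * Y \<omega>)) = exp (- a\<^sup>2 * s / 2)"
      unfolding Y_def by (rule expectation_cos_sampled[OF s \<delta>])
    have "(2 * real k + 1) * (pi * Y \<omega> / (2 * \<delta>)) = a * Y \<omega>" for \<omega> by (simp add: a_def)
    hence "expectation (f k) = (-1) ^ k * expectation (\<lambda>\<omega>. cos (a * Y \<omega>)) / (2 * real k + 1) ^ 3"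
      by (simp add: f_def[abs_def])
    moreover have exponent: "- a\<^sup>2 * s / 2 = - (2 * real k + 1)\<^sup>2 * (s * pi\<^sup>2 / (8 * \<delta>\<^sup>2))"
      by (simp add: a_def power_divide power_mult_distrib)
    ultimately show ?thesis using E by (simp only: exponent)
  qed
  with sums show ?thesis by simp
qed

section \<open>The distortion\<close>

text \<open>Fubini needs joint measurability in time and \<omega>. It comes from sampling the path
  at multiples of 1/(n+1), using continuity; \<open>max 0\<close> shields the unconstrained negative
  times.\<close>

lemma (in standard_brownian_motion) measurable_process:
  "(\<lambda>p. x (max 0 (fst p)) (snd p)) \<in> borel_measurable ((borel :: real measure) \<Otimes>\<^sub>M M)"
proof (rule borel_measurable_LIMSEQ_real)
  \<comment> \<open>Conversion to \<open>nat\<close> sends negative values to 0, so the step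
    approximation at a negative time already agrees with the one at \<open>max 0\<close> of
    it.\<close>
  define i where "i n s = nat \<lfloor>s * real (Suc n)\<rfloor>" for n and s :: real
  fix p assume "p \<in> space ((borel :: real measure) \<Otimes>\<^sub>M M)"
  hence \<omega>: "snd p \<in> space M" by (auto simp: space_pair_measure)
  define s where "s = max 0 (fst p)"
  have "(\<lambda>n. real (i n s) / real (Suc n)) \<longlonglongrightarrow> s"
  proof (rule tendsto_sandwich)
    have real_i: "real (i n s) = of_int \<lfloor>s * real (Suc n)\<rfloor>" for n
      unfolding i_def by (intro of_nat_nat) (simp add: s_def)
    have bounds: "s * real (Suc n) - 1 \<le> real (i n s)" "real (i n s) \<le> s * real (Suc n)" for n
      unfolding real_i by linarith+
    have lower: "s - inverse (real (Suc n)) = (s * real (Suc n) - 1) / real (Suc n)" for n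
      by (simp add: diff_divide_distrib inverse_eq_divide del: of_nat_Suc)
    show "\<forall>\<^sub>F n in sequentially. s - inverse (real (Suc n)) \<le> real (i n s) / real (Suc n)"
      unfolding lower by (intro always_eventually allI divide_right_mono bounds) simp
    show "\<forall>\<^sub>F n in sequentially. real (i n s) / real (Suc n) \<le> s"
      using bounds(2) by (intro always_eventually allI) (simp add: divide_le_eq del: of_nat_Suc)
    show "(\<lambda>n. s - inverse (real (Suc n))) \<longlonglongrightarrow> s"
      using tendsto_diff[OF tendsto_const LIMSEQ_inverse_real_of_nat, of s] by simp
  qed simp
  moreover have "i n (fst p) = i n s" for n
  proof (cases "0 \<le> fst p")
    case False
    hence "fst p * real (Suc n) \<le> 0" by (intro mult_nonpos_nonneg) auto
    hence "\<lfloor>fst p * real (Suc n)\<rfloor> \<le> 0" by linarith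
    thus ?thesis using False by (simp add: i_def s_def)
  qed (simp add: i_def s_def)
  ultimately show "(\<lambda>n. x (real (i n (fst p)) / real (Suc n)) (snd p)) \<longlonglongrightarrow> x (max 0 (fst p)) (snd p)"
    unfolding s_def[symmetric] by (intro continuous_LIMSEQ[OF continuous_paths[OF \<omega>]]) auto
next
  fix n :: nat
  show "(\<lambda>p. x (real (nat \<lfloor>fst p * real (Suc n)\<rfloor>) / real (Suc n)) (snd p)) \<in> borel_measurable ((borel :: real measure) \<Otimes>\<^sub>M M)"
  proof (rule measurable_compose_countable[where f = "\<lambda>i p. x (real i / real (Suc n)) (snd p)"])
    have [measurable]: "random_variable borel (x (real i / real (Suc n)))" for i
      by (intro measurable) auto
    show "(\<lambda>p. x (real i / real (Suc n)) (snd p)) \<in> borel_measurable ((borel :: real measure) \<Otimes>\<^sub>M M)" for i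
      by measurable
  qed measurable
qed

text \<open>Fubini moves the expectation inside. For each s the cross term has mean 0 and E[x_s^2] =
  s, so the integral of s over [0,T] remains.\<close>

lemma (in standard_brownian_motion) integrated_error:
  assumes T: "0 \<le> T" and \<delta>: "0 < \<delta>"
  defines "e \<equiv> \<lambda>s \<omega>. (x s \<omega>)\<^sup>2 - 2 * ((x s \<omega> - x (min (sampling_time x \<delta> T \<omega>) s) \<omega>) * x (min (sampling_time x \<delta> T \<omega>) s) \<omega>)"
  shows "integrable M (\<lambda>\<omega>. LINT s:{0..T}|lborel. e s \<omega>)"
    and "expectation (\<lambda>\<omega>. LINT s:{0..T}|lborel. e s \<omega>) = T\<^sup>2 / 2"
proof -
  interpret pair_sigma_finite "lborel :: real measure" M ..
  define \<sigma> where "\<sigma> = sampling_time x \<delta> T"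
  have [measurable]: "random_variable borel \<sigma>"
    unfolding \<sigma>_def by (rule measurable_sampling_time[OF T \<delta>])
  define X where "X s \<omega> = x (max 0 s) \<omega>" for s \<omega>
  have X[measurable]: "(\<lambda>p. X (fst p) (snd p)) \<in> borel_measurable ((borel :: real measure) \<Otimes>\<^sub>M M)"
    unfolding X_def by (rule measurable_process)
  define F where "F p = indicator {0..T} (fst p) *
    ((X (fst p) (snd p))\<^sup>2 - 2 * ((X (fst p) (snd p) - X (min (\<sigma> (snd p)) (fst p)) (snd p)) * X (min (\<sigma> (snd p)) (fst p)) (snd p)))" for p
  \<comment> \<open>With a = x_s and b the stopped value, |a^2 - 2ab + 2b^2| is at most a^2 + (a^2 +
    b^2) + 2b^2, and |b| is at most \<delta>.\<close>
  define D where "D p = indicator {0..T} (fst p) * (2 * (X (fst p) (snd p))\<^sup>2 + 3 * \<delta>\<^sup>2)" for p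
  have sets_eq[measurable_cong]: "sets ((lborel :: real measure) \<Otimes>\<^sub>M M) = sets ((borel :: real measure) \<Otimes>\<^sub>M M)"
    by (intro sets_pair_measure_cong) auto
  have stopped[measurable]: "(\<lambda>p. X (min (\<sigma> (snd p)) (fst p)) (snd p)) \<in> borel_measurable ((borel :: real measure) \<Otimes>\<^sub>M M)"
    using measurable_compose[OF _ X, of "\<lambda>p. (min (\<sigma> (snd p)) (fst p), snd p)" "(borel :: real measure) \<Otimes>\<^sub>M M"] by simp
  have F_meas[measurable]: "F \<in> borel_measurable ((lborel :: real measure) \<Otimes>\<^sub>M M)"
    unfolding F_def[abs_def] by measurable
  have D_meas[measurable]: "D \<in> borel_measurable ((lborel :: real measure) \<Otimes>\<^sub>M M)"
    unfolding D_def[abs_def] by measurable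
  have \<sigma>: "0 \<le> \<sigma> \<omega>" "\<And>s. 0 \<le> s \<Longrightarrow> s \<le> T \<Longrightarrow> min (\<sigma> \<omega>) s = sampling_time x \<delta> s \<omega>"
    "\<And>s. 0 \<le> s \<Longrightarrow> s \<le> T \<Longrightarrow> \<bar>x (min (\<sigma> \<omega>) s) \<omega>\<bar> \<le> \<delta>" if "\<omega> \<in> space M" for \<omega>
  proof -
    note path = continuous_paths[OF that] start_at_zero[OF that] \<delta>
    show 1: "min (\<sigma> \<omega>) s = sampling_time x \<delta> s \<omega>" if "0 \<le> s" "s \<le> T" for s
      unfolding \<sigma>_def by (rule sampling_time_min[of x \<omega> \<delta> T, OF path T that])
    show "0 \<le> \<sigma> \<omega>" unfolding \<sigma>_def by (rule sampling_time_nonneg[of x \<omega> \<delta> T, OF path T])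
    show "\<bar>x (min (\<sigma> \<omega>) s) \<omega>\<bar> \<le> \<delta>" if "0 \<le> s" "s \<le> T" for s
      unfolding 1[OF that] by (rule abs_sampled_le[of x \<omega> \<delta> s, OF path that(1)])
  qed
  have F_eq: "F (s, \<omega>) = indicator {0..T} s * e s \<omega>" if "\<omega> \<in> space M" for s \<omega>
    using \<sigma>(1)[OF that] by (auto simp: F_def e_def X_def \<sigma>_def indicator_def)
  have D_int: "integrable ((lborel :: real measure) \<Otimes>\<^sub>M M) D"
  proof (rule Fubini_integrable[OF D_meas])
    have inner: "integrable M (\<lambda>\<omega>. D (s, \<omega>))" "expectation (\<lambda>\<omega>. norm (D (s, \<omega>))) = indicator {0..T} s * (2 * s + 3 * \<delta>\<^sup>2)" for s
      using integrable_square[of s] expectation_square[of s]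
      by (auto simp: D_def X_def indicator_def prob_space)
    show "AE s in lborel. integrable M (\<lambda>\<omega>. D (s, \<omega>))"
      using inner by simp
    have "set_integrable lborel {0..T} (\<lambda>s. 2 * s + 3 * \<delta>\<^sup>2)"
      by (intro borel_integrable_atLeastAtMost' continuous_intros)
    thus "integrable lborel (\<lambda>s. expectation (\<lambda>\<omega>. norm (D (s, \<omega>))))"
      unfolding inner(2) by (simp add: set_integrable_def)
  qed
  have F_int: "integrable ((lborel :: real measure) \<Otimes>\<^sub>M M) F"
  proof (rule Bochner_Integration.integrable_bound[OF D_int F_meas AE_I2])
    fix p assume "p \<in> space ((lborel :: real measure) \<Otimes>\<^sub>M M)"
    then obtain s \<omega> where p: "p = (s, \<omega>)" and \<omega>: "\<omega> \<in> space M" by (auto simp: space_pair_measure)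
    show "norm (F p) \<le> norm (D p)"
    proof (cases "s \<in> {0..T}")
      case True
      define a b where "a = x s \<omega>" and "b = x (min (\<sigma> \<omega>) s) \<omega>"
      have "b\<^sup>2 \<le> \<delta>\<^sup>2" using power_mono[OF \<sigma>(3)[OF \<omega>, of s], of 2] True by (simp add: b_def)
      moreover have "(a - b) * b = a * b - b\<^sup>2" by (simp add: power2_eq_square algebra_simps)
      moreover have "2 * (a * b) \<le> a\<^sup>2 + b\<^sup>2" "- 2 * (a * b) \<le> a\<^sup>2 + b\<^sup>2"
        using zero_le_power2[of "a - b"] zero_le_power2[of "a + b"] by (simp_all add: power2_diff power2_sum)
      moreover have "0 \<le> a\<^sup>2" "0 \<le> b\<^sup>2" by simp_all
      ultimately have "\<bar>a\<^sup>2 - 2 * ((a - b) * b)\<bar> \<le> 2 * a\<^sup>2 + 3 * \<delta>\<^sup>2" by linarith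
      thus ?thesis
        using True by (simp add: p F_eq[OF \<omega>] D_def e_def X_def a_def b_def \<sigma>_def)
    qed (simp add: p F_eq[OF \<omega>])
  qed
  have inner_eq: "(\<integral>s. F (s, \<omega>) \<partial>lborel) = (LINT s:{0..T}|lborel. e s \<omega>)" if "\<omega> \<in> space M" for \<omega>
    unfolding F_eq[OF that] set_lebesgue_integral_def by simp
  have "integrable M (\<lambda>\<omega>. \<integral>s. F (s, \<omega>) \<partial>lborel)"
    using integrable_snd[of "\<lambda>s \<omega>. F (s, \<omega>)"] F_int by simp
  thus "integrable M (\<lambda>\<omega>. LINT s:{0..T}|lborel. e s \<omega>)"
    by (subst (asm) Bochner_Integration.integrable_cong[OF refl inner_eq])
  have "expectation (\<lambda>\<omega>. LINT s:{0..T}|lborel. e s \<omega>) = expectation (\<lambda>\<omega>. \<integral>s. F (s, \<omega>) \<partial>lborel)"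
    by (intro Bochner_Integration.integral_cong refl inner_eq[symmetric])
  also have "\<dots> = (\<integral>s. expectation (\<lambda>\<omega>. F (s, \<omega>)) \<partial>lborel)"
    using Fubini_integral[of "\<lambda>s \<omega>. F (s, \<omega>)"] F_int by simp
  also have "\<dots> = (LINT s:{0..T}|lborel. s)"
    unfolding set_lebesgue_integral_def
  proof (intro Bochner_Integration.integral_cong refl)
    fix s
    show "expectation (\<lambda>\<omega>. F (s, \<omega>)) = indicator {0..T} s *\<^sub>R s"
    proof (cases "s \<in> {0..T}")
      case True
      hence s: "0 \<le> s" "s \<le> T" by auto
      \<comment> \<open>For this fixed s the stopped value is the sample with horizon s, so
        \<open>sampled_increment\<close> applies with s in place of T.\<close>
      define Y where "Y \<omega> = x (sampling_time x \<delta> s \<omega>) \<omega>" for \<omega>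
      have "expectation (\<lambda>\<omega>. F (s, \<omega>)) = expectation (\<lambda>\<omega>. (x s \<omega>)\<^sup>2 - 2 * ((x s \<omega> - Y \<omega>) * Y \<omega>))"
        using True \<sigma>(2)[OF _ s]
        by (intro Bochner_Integration.integral_cong refl) (simp add: F_eq e_def Y_def \<sigma>_def)
      also have "\<dots> = s"
        using integrable_sampled_increment[OF s(1) \<delta>] expectation_sampled_increment[OF s(1) \<delta>]
          integrable_square[OF s(1)] expectation_square[OF s(1)] by (simp add: Y_def)
      finally show ?thesis using True by simp
    next
      case False
      have "expectation (\<lambda>\<omega>. F (s, \<omega>)) = expectation (\<lambda>\<omega>. 0)"
        using False by (intro Bochner_Integration.integral_cong refl) (simp add: F_eq)
      thus ?thesis using False by simp
    qed
  qed
  also have "\<dots> = T\<^sup>2 / 2"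
  proof -
    have "(\<integral>s. s * indicator {0..T} s \<partial>lborel) = T\<^sup>2 / 2 - 0\<^sup>2 / 2"
      by (rule integral_FTC_Icc_real[OF T]) (auto intro!: derivative_eq_intros)
    thus ?thesis by (simp add: set_lebesgue_integral_def mult.commute)
  qed
  finally show "expectation (\<lambda>\<omega>. LINT s:{0..T}|lborel. e s \<omega>) = T\<^sup>2 / 2" .
qed

text \<open>Up to \<sigma> the stopped path equals the path and the cross term vanishes. After
  \<sigma> the square expands into the common integrand minus (f \<sigma>)^2, whose integral is the
  subtracted term.\<close>

lemma squared_error_eq:
  assumes cont: "continuous_on {0..} (\<lambda>t. x t \<omega>)" and zero: "x 0 \<omega> = 0" and \<delta>: "0 < \<delta>" and T: "0 \<le> T"
  defines "\<sigma> \<equiv> sampling_time x \<delta> T \<omega>"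
  shows "squared_error x \<delta> T \<omega> =
    (LINT s:{0..T}|lborel. (x s \<omega>)\<^sup>2 - 2 * ((x s \<omega> - x (min \<sigma> s) \<omega>) * x (min \<sigma> s) \<omega>)) - \<delta>\<^sup>2 * (T - \<sigma>)"
proof -
  define f where "f s = x s \<omega>" for s
  have f: "continuous_on {0..} f" using cont by (simp add: f_def[abs_def])
  have \<sigma>: "0 \<le> \<sigma>" "\<sigma> \<le> T"
    unfolding \<sigma>_def by (rule sampling_time_nonneg[of x \<omega> \<delta> T] sampling_time_le[of x \<omega> \<delta> T]; fact)+
  \<comment> \<open>At a time-out |f \<sigma>| may be smaller than \<delta>, but then the factor T -
    \<sigma> is 0.\<close>
  have stop: "(f \<sigma>)\<^sup>2 * (T - \<sigma>) = \<delta>\<^sup>2 * (T - \<sigma>)"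
  proof (cases "\<sigma> < T")
    case True
    hence "\<bar>f \<sigma>\<bar> = \<delta>"
      using abs_sampled_eq[of x \<omega> \<delta> T, OF cont zero \<delta> T] by (simp add: \<sigma>_def f_def)
    thus ?thesis by (metis power2_abs)
  qed (use \<sigma> in simp)
  have f_on: "continuous_on S f" if "S \<subseteq> {0..}" for S
    by (rule continuous_on_subset[OF f that])
  have 1: "set_integrable lborel {0..\<sigma>} (\<lambda>s. (f s)\<^sup>2)"
    by (intro borel_integrable_atLeastAtMost' continuous_intros f_on) auto
  have 2: "set_integrable lborel {\<sigma>..T} (\<lambda>s. (f s - f \<sigma>)\<^sup>2)"
    using \<sigma> by (intro borel_integrable_atLeastAtMost' continuous_intros f_on) auto
  have 3: "set_integrable lborel {0..T} (\<lambda>s. (f s)\<^sup>2 - 2 * ((f s - f (min \<sigma> s)) * f (min \<sigma> s)))"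
  proof -
    have "continuous_on {0..T} (\<lambda>s. f (min \<sigma> s))"
      using \<sigma> by (intro continuous_on_compose2[OF f] continuous_intros) auto
    thus ?thesis by (intro borel_integrable_atLeastAtMost' continuous_intros f_on) auto
  qed
  have 4: "set_integrable lborel {\<sigma>..T} (\<lambda>s. (f \<sigma>)\<^sup>2)"
    by (intro borel_integrable_atLeastAtMost' continuous_intros)
  have "squared_error x \<delta> T \<omega> = (LINT s:{0..\<sigma>}|lborel. (f s)\<^sup>2) + (LINT s:{\<sigma>..T}|lborel. (f s - f \<sigma>)\<^sup>2)"
    by (simp add: squared_error_def \<sigma>_def f_def Let_def)
  also have "\<dots> = (\<integral>s. indicator {0..\<sigma>} s *\<^sub>R (f s)\<^sup>2 + indicator {\<sigma>..T} s *\<^sub>R (f s - f \<sigma>)\<^sup>2 \<partial>lborel)"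
    using 1 2 unfolding set_lebesgue_integral_def set_integrable_def
    by (rule Bochner_Integration.integral_add[symmetric])
  also have "\<dots> = (\<integral>s. indicator {0..T} s *\<^sub>R ((f s)\<^sup>2 - 2 * ((f s - f (min \<sigma> s)) * f (min \<sigma> s)))
      - indicator {\<sigma>..T} s *\<^sub>R (f \<sigma>)\<^sup>2 \<partial>lborel)"
  proof (rule integral_cong_AE)
    \<comment> \<open>Both closed intervals contain \<sigma>, where the two integrands can differ,
      so equality is claimed only almost everywhere.\<close>
    have "AE s in lborel. s \<noteq> \<sigma>" by (rule AE_lborel_singleton)
    thus "AE s in lborel. indicator {0..\<sigma>} s *\<^sub>R (f s)\<^sup>2 + indicator {\<sigma>..T} s *\<^sub>R (f s - f \<sigma>)\<^sup>2 =
        indicator {0..T} s *\<^sub>R ((f s)\<^sup>2 - 2 * ((f s - f (min \<sigma> s)) * f (min \<sigma> s))) - indicator {\<sigma>..T} s *\<^sub>R (f \<sigma>)\<^sup>2"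
      by (rule AE_mp) (use \<sigma> in \<open>auto intro!: AE_I2 simp: indicator_def min_def power2_eq_square algebra_simps\<close>)
  qed (use 1 2 3 4 in \<open>auto simp: set_integrable_def intro!: borel_measurable_add borel_measurable_diff dest!: borel_measurable_integrable\<close>)
  also have "\<dots> = (LINT s:{0..T}|lborel. (f s)\<^sup>2 - 2 * ((f s - f (min \<sigma> s)) * f (min \<sigma> s))) - (LINT s:{\<sigma>..T}|lborel. (f \<sigma>)\<^sup>2)"
    using 3 4 unfolding set_lebesgue_integral_def set_integrable_def
    by (rule Bochner_Integration.integral_diff)
  also have "(LINT s:{\<sigma>..T}|lborel. (f \<sigma>)\<^sup>2) = \<delta>\<^sup>2 * (T - \<sigma>)"
    using \<sigma> stop by (simp add: set_lebesgue_integral_def mult.commute)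
  finally show ?thesis by (simp add: f_def)
qed

theorem mainTheorem2:
  fixes M :: "'a measure" and x :: "real \<Rightarrow> 'a \<Rightarrow> real" and T \<delta> lam :: real
  assumes "standard_brownian_motion M x"
    and "T > 0" and "\<delta> > 0"
    and "lam = T * pi\<^sup>2 / (8 * \<delta>\<^sup>2)"
  shows "integrable M (squared_error x \<delta> T) \<and>
    prob_space.expectation M (squared_error x \<delta> T) =
      T\<^sup>2 / 2 * (1 + pi ^ 4 / (32 * lam\<^sup>2) - pi\<^sup>2 / (4 * lam)
        - pi / lam\<^sup>2 * (\<Sum>k. (-1) ^ k * exp (- (2 * real k + 1)\<^sup>2 * lam) / (2 * real k + 1) ^ 3))"
proof -
  interpret standard_brownian_motion M x by fact
  have T: "0 \<le> T" and \<delta>: "0 < \<delta>" using assms by auto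
  define \<sigma> where "\<sigma> = sampling_time x \<delta> T"
  define J where "J \<omega> = (LINT s:{0..T}|lborel. (x s \<omega>)\<^sup>2 - 2 * ((x s \<omega> - x (min (\<sigma> \<omega>) s) \<omega>) * x (min (\<sigma> \<omega>) s) \<omega>))" for \<omega>
  have J: "integrable M J" "expectation J = T\<^sup>2 / 2"
    unfolding J_def[abs_def] \<sigma>_def by (rule integrated_error[OF T \<delta>])+
  have [measurable]: "random_variable borel \<sigma>"
    unfolding \<sigma>_def by (rule measurable_sampling_time[OF T \<delta>])
  have int_\<sigma>: "integrable M \<sigma>"
  proof (rule integrable_const_bound[where B = T])
    show "AE \<omega> in M. norm (\<sigma> \<omega>) \<le> T"
      using sampling_time_nonneg[of x _ \<delta> T] sampling_time_le[of x _ \<delta> T] continuous_paths start_at_zero \<delta> T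
      by (intro AE_I2) (simp add: \<sigma>_def)
  qed measurable
  have err: "squared_error x \<delta> T \<omega> = J \<omega> - \<delta>\<^sup>2 * (T - \<sigma> \<omega>)" if "\<omega> \<in> space M" for \<omega>
    unfolding J_def \<sigma>_def
    by (rule squared_error_eq[of x \<omega> \<delta> T, OF continuous_paths[OF that] start_at_zero[OF that] \<delta> T])
  \<comment> \<open>Integrability gives the value its meaning: the integral of a non-integrable
    function is 0 by convention.\<close>
  have int: "integrable M (squared_error x \<delta> T)"
    by (subst Bochner_Integration.integrable_cong[OF refl err]) (use J int_\<sigma> in auto)
  have E: "expectation (squared_error x \<delta> T) = T\<^sup>2 / 2 - \<delta>\<^sup>2 * (T - expectation \<sigma>)"
    by (subst Bochner_Integration.integral_cong[OF refl err]) (use J int_\<sigma> in \<open>auto simp: prob_space\<close>)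
  define S where "S = (\<Sum>k. (-1) ^ k * exp (- (2 * real k + 1)\<^sup>2 * lam) / (2 * real k + 1) ^ 3)"
  have "S = pi ^ 3 / (32 * \<delta>\<^sup>2) * (\<delta>\<^sup>2 - expectation \<sigma>)"
    unfolding S_def \<sigma>_def assms(4) by (rule sums_unique[OF expectation_sampling_time[OF T \<delta>], symmetric])
  hence "expectation \<sigma> = \<delta>\<^sup>2 - 32 * \<delta>\<^sup>2 / pi ^ 3 * S"
    using \<delta> by (simp add: field_simps)
  \<comment> \<open>Expressing \<delta>^2 through \<open>T\<close> and \<open>lam\<close> eliminates
    \<delta>. In T^2/2 - d T + d^2 - 32 d^2 S / pi^3 the last three terms then become the three
    \<lambda>-dependent terms of the formula.\<close>
  moreover define d where "d = \<delta>\<^sup>2"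
  moreover have d: "d = T * pi\<^sup>2 / (8 * lam)" and lam: "0 < lam"
    using assms by (simp_all add: d_def)
  ultimately have "expectation (squared_error x \<delta> T) = T\<^sup>2 / 2 - d * (T - (d - 32 * d / pi ^ 3 * S))"
    using E by simp
  also have "\<dots> = T\<^sup>2 / 2 * (1 + pi ^ 4 / (32 * lam\<^sup>2) - pi\<^sup>2 / (4 * lam) - pi / lam\<^sup>2 * S)"
    unfolding d using lam by (simp add: field_simps power2_eq_square power3_eq_cube power4_eq_xxxx)
  finally show ?thesis using int by (simp add: S_def)
qed

end
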